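(* Let $\mathscr{T}$ be a T-mesh, let $c$ be the number of its cross-cuts, $t$ the number of its T $l$-edges, $n_v$ the number of its interior vertices, and let its completely non-diagonalizable component (CNDC) be $\{l_1,\dots,l_s\}$. Then $$\dim S_{d}(\mathscr{T}) \le U_K(\mathscr{T}),$$ $$U_K(\mathscr{T}):=(d+1)^2 + (c-t)(d+1) + n_v + \min_{\pi} \sum_{i=1}^s \big[ m(l_i) - n(l_i) + d + 1 - u_\pi^-(l_i) \big]_+ ,$$ where the minimum is over all permutations (orderings) $\pi$ of the $s$ T $l$-edges of the CNDC, $n(l_i)$ and $m(l_i)$ are the numbers of vertices and of multi-vertices on $l_i$, $u_\pi^-(l_i)$ is the number of multi-vertices on $l_i$ shared with CNDC edges that precede $l_i$ in the ordering $\pi$, and $[\cdot]_+=\max\{\cdot,0\}$.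
   Context: Let $d\ge 1$ be an integer. A T-mesh $\mathscr T$ is a partition of a simply connected planar domain $\Phi$ into finitely many axis-aligned rectangles (cells), with T-junctions allowed. Vertices are the grid points of the mesh; a T-junction is an interior vertex of valence 3. An edge is a segment joining two adjacent vertices along a horizontal or vertical grid line; edges are boundary or interior. An $l$-edge is a maximal straight segment composed of collinear contiguous edges whose endpoints are T-junctions or boundary vertices. An interior $l$-edge is a cross-cut if both endpoints lie on the domain boundary, a T $l$-edge if both endpoints are T-junctions, and a ray otherwise. The T-connected component $T(\mathscr T)$ is the set of all T $l$-edges (with the vertices on them). For a T $l$-edge $l$, $n(l)$ is the number of vertices on $l$, endpoints included. $S_d(\mathscr T)$ is the space of functions $s$ on $\Phi$ that are $d-1$ times continuously differentiable in $x$ and $d-1$ times continuously differentiable in $y$ (class $C^{d-1,d-1}(\Phi)$) and whose restriction to every cell is a polynomial of bi-degree at most $(d,d)$. Standing assumptions: $T(\mathscr T)$ is connected (assumed without loss of generality), and no T $l$-edge is vanishable, i.e. $n(l)\ge d+2$ for every T $l$-edge $l$. CNDC. A sub-component of $T(\mathscr T)$ is a set of T $l$-edges with the vertices on them. A reasonable order is an ordering $l_1\succ l_2\succ\cdots$ such that for each $i$ the number of vertices remaining on $l_i$ after deleting its intersections with the preceding edges $l_j$, $j<i$, is at least $d+1$. $\mathscr T$ is diagonalizable if $T(\mathscr T)$ has a reasonable order. Let $\mathscr T$ be non-diagonalizable. A partition $\{T_1,T_2\}$ of the T $l$-edges, with $T_2=T(\mathscr T)\setminus T_1$ (vertices lying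 on edges of $T_1$ are deleted from the edges of $T_2$), is regular if $T_1$ has no reasonable order and $T_2$ has one ($T_2$ may be empty). A regular partition is complete if there is no other regular partition $\{T_1',T_2'\}$ with $T_1'$ a proper subset of $T_1$. The complete partition is unique; $T_1=\{l_1,\dots,l_s\}$ is called the CNDC. A multi-vertex of the CNDC is a vertex that is the intersection of two T $l$-edges of $T_1$ (one horizontal, one vertical). *)

theory Defs
  imports
    "HOL-Analysis.Analysis"
    "HOL-Library.Function_Algebras"
    "HOL-Combinatorics.Multiset_Permutations"
begin

section \<open>T-meshes\<close>

text \<open>
  A mesh is given by its finite set of cells; its domain is their union. A union of rectangles
  that is simply connected and has a connected interior is the closure of a planar domain and has
  no two parts that merely touch in a point.
\<close>

definition T_mesh :: "(real \<times> real) set set \<Rightarrow> bool" where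
  "T_mesh M \<longleftrightarrow> M \<noteq> {} \<and> M division_of \<Union>M \<and> (\<forall>K\<in>M. interior K \<noteq> {}) \<and>
     simply_connected (\<Union>M) \<and> connected (interior (\<Union>M))"

text \<open>In a partition into rectangles the grid points are exactly the corners of the cells.\<close>

definition vertices :: "(real \<times> real) set set \<Rightarrow> (real \<times> real) set" where
  "vertices M = {(x, y). \<exists>a b. cbox a b \<in> M \<and> x \<in> {fst a, fst b} \<and> y \<in> {snd a, snd b}}"

definition interior_vertices :: "(real \<times> real) set set \<Rightarrow> (real \<times> real) set" where
  "interior_vertices M = vertices M \<inter> interior (\<Union>M)"

definition boundary_vertices :: "(real \<times> real) set set \<Rightarrow> (real \<times> real) set" where
  "boundary_vertices M = vertices M \<inter> frontier (\<Union>M)"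

definition horizontal :: "(real \<times> real) set \<Rightarrow> bool" where
  "horizontal l \<longleftrightarrow> (\<exists>a b y. a < b \<and> l = closed_segment (a, y) (b, y))"

definition vertical :: "(real \<times> real) set \<Rightarrow> bool" where
  "vertical l \<longleftrightarrow> (\<exists>x a b. a < b \<and> l = closed_segment (x, a) (x, b))"

text \<open>The grid lines make up the union of the frontiers of the cells.\<close>

definition edges :: "(real \<times> real) set set \<Rightarrow> (real \<times> real) set set" where
  "edges M = {closed_segment u v | u v. u \<in> vertices M \<and> v \<in> vertices M \<and>
     (horizontal (closed_segment u v) \<or> vertical (closed_segment u v)) \<and>
     closed_segment u v \<subseteq> (\<Union>K\<in>M. frontier K) \<and> open_segment u v \<inter> vertices M = {}}"

definition interior_edges :: "(real \<times> real) set set \<Rightarrow> (real \<times> real) set set" where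
  "interior_edges M = {e \<in> edges M. \<not> e \<subseteq> frontier (\<Union>M)}"

definition valence :: "(real \<times> real) set set \<Rightarrow> real \<times> real \<Rightarrow> nat" where
  "valence M v = card {e \<in> edges M. v \<in> e}"

definition T_junctions :: "(real \<times> real) set set \<Rightarrow> (real \<times> real) set" where
  "T_junctions M = {v \<in> interior_vertices M. valence M v = 3}"

definition interior_runs :: "(real \<times> real) set set \<Rightarrow> (real \<times> real) set set" where
  "interior_runs M = {l. (horizontal l \<or> vertical l) \<and> (\<exists>E \<subseteq> interior_edges M. l = \<Union>E)}"

definition interior_l_edges :: "(real \<times> real) set set \<Rightarrow> (real \<times> real) set set" where
  "interior_l_edges M = {l \<in> interior_runs M. (\<forall>l' \<in> interior_runs M. \<not> l \<subset> l') \<and>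
     (\<exists>u v. l = closed_segment u v \<and> {u, v} \<subseteq> T_junctions M \<union> boundary_vertices M)}"

definition cross_cuts :: "(real \<times> real) set set \<Rightarrow> (real \<times> real) set set" where
  "cross_cuts M = {l \<in> interior_l_edges M.
     \<exists>u v. l = closed_segment u v \<and> {u, v} \<subseteq> boundary_vertices M}"

definition T_l_edges :: "(real \<times> real) set set \<Rightarrow> (real \<times> real) set set" where
  "T_l_edges M = {l \<in> interior_l_edges M.
     \<exists>u v. l = closed_segment u v \<and> {u, v} \<subseteq> T_junctions M}"

definition num_vertices :: "(real \<times> real) set set \<Rightarrow> (real \<times> real) set \<Rightarrow> nat" where
  "num_vertices M l = card (vertices M \<inter> l)"

definition vanishable :: "nat \<Rightarrow> (real \<times> real) set set \<Rightarrow> (real \<times> real) set \<Rightarrow> bool" where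
  "vanishable d M l \<longleftrightarrow> num_vertices M l < d + 2"


section \<open>Reasonable orders and the completely non-diagonalizable component\<close>

text \<open>
  A sub-component is a set \<open>A\<close> of T l-edges together with the vertices on them, except for those in
  \<open>\<Union>D\<close>: the set \<open>D\<close> holds the edges whose vertices have been deleted beforehand.
\<close>

definition reasonable_order ::
    "nat \<Rightarrow> (real \<times> real) set set \<Rightarrow> (real \<times> real) set set \<Rightarrow> (real \<times> real) set set \<Rightarrow>
     (real \<times> real) set list \<Rightarrow> bool" where
  "reasonable_order d M D A ls \<longleftrightarrow> ls \<in> permutations_of_set A \<and>
     (\<forall>i < length ls. d + 1 \<le> card ((vertices M \<inter> ls ! i) - \<Union>D - \<Union>(set (take i ls))))"

definition diagonalizable :: "nat \<Rightarrow> (real \<times> real) set set \<Rightarrow> bool" where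
  "diagonalizable d M \<longleftrightarrow> (\<exists>ls. reasonable_order d M {} (T_l_edges M) ls)"

text \<open>The partition \<open>{T1, T2}\<close> is represented by \<open>T1\<close>.\<close>

definition regular_partition ::
    "nat \<Rightarrow> (real \<times> real) set set \<Rightarrow> (real \<times> real) set set \<Rightarrow> bool" where
  "regular_partition d M T1 \<longleftrightarrow> T1 \<subseteq> T_l_edges M \<and>
     (\<nexists>ls. reasonable_order d M {} T1 ls) \<and>
     (\<exists>ls. reasonable_order d M T1 (T_l_edges M - T1) ls)"

definition is_CNDC :: "nat \<Rightarrow> (real \<times> real) set set \<Rightarrow> (real \<times> real) set set \<Rightarrow> bool" where
  "is_CNDC d M C \<longleftrightarrow> \<not> diagonalizable d M \<and> regular_partition d M C \<and>
     (\<nexists>T1. regular_partition d M T1 \<and> T1 \<subset> C)"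

definition multi_vertices ::
    "(real \<times> real) set set \<Rightarrow> (real \<times> real) set set \<Rightarrow> (real \<times> real) set" where
  "multi_vertices M C =
     {v \<in> vertices M. \<exists>h\<in>C. \<exists>k\<in>C. horizontal h \<and> vertical k \<and> v \<in> h \<inter> k}"

definition num_multi ::
    "(real \<times> real) set set \<Rightarrow> (real \<times> real) set set \<Rightarrow> (real \<times> real) set \<Rightarrow> nat" where
  "num_multi M C l = card (multi_vertices M C \<inter> l)"

definition u_minus ::
    "(real \<times> real) set set \<Rightarrow> (real \<times> real) set set \<Rightarrow> (real \<times> real) set list \<Rightarrow> nat \<Rightarrow> nat" where
  "u_minus M C ls i = card (multi_vertices M C \<inter> ls ! i \<inter> \<Union>(set (take i ls)))"

definition U_K :: "nat \<Rightarrow> (real \<times> real) set set \<Rightarrow> (real \<times> real) set set \<Rightarrow> int" where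
  "U_K d M C =
     (int d + 1)^2 + (int (card (cross_cuts M)) - int (card (T_l_edges M))) * (int d + 1)
     + int (card (interior_vertices M))
     + (MIN ls \<in> permutations_of_set C. \<Sum>i < card C.
          max 0 (int (num_multi M C (ls ! i)) - int (num_vertices M (ls ! i)) + int d + 1
                 - int (u_minus M C ls i)))"


section \<open>The spline space\<close>

text \<open>
  \<open>C_dir k e \<Phi> s\<close>: the function \<open>s\<close> is \<open>k\<close> times continuously differentiable on \<open>\<Phi>\<close> in the
  direction \<open>e\<close>, with \<open>g i\<close> as the \<open>i\<close>-th derivative. At a boundary point the difference quotient
  is taken within \<open>\<Phi>\<close> (it is one-sided if the line leaves \<open>\<Phi>\<close> there). Continuity of the
  derivatives is joint continuity in both variables.
\<close>

definition C_dir ::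
    "nat \<Rightarrow> real \<times> real \<Rightarrow> (real \<times> real) set \<Rightarrow> (real \<times> real \<Rightarrow> real) \<Rightarrow> bool" where
  "C_dir k e \<Phi> s \<longleftrightarrow> (\<exists>g. (\<forall>p\<in>\<Phi>. g 0 p = s p) \<and> (\<forall>i\<le>k. continuous_on \<Phi> (g i)) \<and>
     (\<forall>i<k. \<forall>p\<in>\<Phi>. ((\<lambda>t. g i (p + t *\<^sub>R e)) has_real_derivative g (Suc i) p)
        (at 0 within {t. p + t *\<^sub>R e \<in> \<Phi>})))"

definition bidegree_poly_on :: "nat \<Rightarrow> (real \<times> real) set \<Rightarrow> (real \<times> real \<Rightarrow> real) \<Rightarrow> bool" where
  "bidegree_poly_on d K s \<longleftrightarrow>
     (\<exists>a. \<forall>(x, y)\<in>K. s (x, y) = (\<Sum>i\<le>d. \<Sum>j\<le>d. a i j * x ^ i * y ^ j))"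

text \<open>
  Functions on \<open>\<Union>M\<close> are represented by functions on the plane that vanish outside \<open>\<Union>M\<close>,
  so that two splines that agree on the domain are equal.
\<close>

definition spline_space :: "nat \<Rightarrow> (real \<times> real) set set \<Rightarrow> (real \<times> real \<Rightarrow> real) set" where
  "spline_space d M = {s. (\<forall>p. p \<notin> \<Union>M \<longrightarrow> s p = 0) \<and>
     C_dir (d - 1) (1, 0) (\<Union>M) s \<and> C_dir (d - 1) (0, 1) (\<Union>M) s \<and>
     (\<forall>K\<in>M. bidegree_poly_on d K s)}"

interpretation real_fun: vector_space "\<lambda>(c::real) (f :: real \<times> real \<Rightarrow> real) p. c * f p"
  by unfold_locales (auto simp: fun_eq_iff algebra_simps)

text \<open>
  The library's \<open>dim\<close> is the dimension of the span, and it is 0 for spaces of infinite dimension.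
  The next two facts show that neither convention matters for \<open>spline_space\<close>.
\<close>

lemma C_dir_lincomb:
  assumes "C_dir k e \<Phi> s" "C_dir k e \<Phi> t"
  shows "C_dir k e \<Phi> (\<lambda>p. a * s p + b * t p)"
proof -
  from assms obtain g h where
    g: "\<forall>p\<in>\<Phi>. g 0 p = s p" "\<forall>i\<le>k. continuous_on \<Phi> (g i)"
       "\<forall>i<k. \<forall>p\<in>\<Phi>. ((\<lambda>t. g i (p + t *\<^sub>R e)) has_real_derivative g (Suc i) p)
          (at 0 within {t. p + t *\<^sub>R e \<in> \<Phi>})" and
    h: "\<forall>p\<in>\<Phi>. h 0 p = t p" "\<forall>i\<le>k. continuous_on \<Phi> (h i)"
       "\<forall>i<k. \<forall>p\<in>\<Phi>. ((\<lambda>t. h i (p + t *\<^sub>R e)) has_real_derivative h (Suc i) p)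
          (at 0 within {t. p + t *\<^sub>R e \<in> \<Phi>})"
    unfolding C_dir_def by (elim exE conjE)
  show ?thesis
    unfolding C_dir_def
  proof (intro exI[of _ "\<lambda>i p. a * g i p + b * h i p"] conjI allI ballI impI)
    fix i assume "i \<le> k"
    then show "continuous_on \<Phi> (\<lambda>p. a * g i p + b * h i p)"
      using g(2) h(2) by (intro continuous_on_add continuous_on_mult continuous_on_const) simp_all
  next
    fix i p assume "i < k" "p \<in> \<Phi>"
    then show "((\<lambda>t. a * g i (p + t *\<^sub>R e) + b * h i (p + t *\<^sub>R e)) has_real_derivative
        a * g (Suc i) p + b * h (Suc i) p) (at 0 within {t. p + t *\<^sub>R e \<in> \<Phi>})"
      using g(3) h(3) by (intro DERIV_add[OF DERIV_cmult DERIV_cmult]) simp_all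
  qed (simp add: g(1) h(1))
qed

lemma bidegree_poly_on_lincomb:
  assumes "bidegree_poly_on d K s" "bidegree_poly_on d K t"
  shows "bidegree_poly_on d K (\<lambda>p. a * s p + b * t p)"
proof -
  from assms obtain f g where
    fg: "\<forall>(x, y)\<in>K. s (x, y) = (\<Sum>i\<le>d. \<Sum>j\<le>d. f i j * x ^ i * y ^ j)"
    "\<forall>(x, y)\<in>K. t (x, y) = (\<Sum>i\<le>d. \<Sum>j\<le>d. g i j * x ^ i * y ^ j)"
    unfolding bidegree_poly_on_def by blast
  have "a * s (x, y) + b * t (x, y) = (\<Sum>i\<le>d. \<Sum>j\<le>d. (a * f i j + b * g i j) * x ^ i * y ^ j)"
    if "(x, y) \<in> K" for x y
  proof -
    have "s (x, y) = (\<Sum>i\<le>d. \<Sum>j\<le>d. f i j * x ^ i * y ^ j)"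
      "t (x, y) = (\<Sum>i\<le>d. \<Sum>j\<le>d. g i j * x ^ i * y ^ j)"
      using fg that by blast+
    then show ?thesis
      by (simp only: sum_distrib_left sum.distrib distrib_right mult.assoc)
  qed
  then show ?thesis
    unfolding bidegree_poly_on_def
    by (intro exI[of _ "\<lambda>i j. a * f i j + b * g i j"]) blast
qed

lemma subspace_spline_space: "real_fun.subspace (spline_space d M)"
proof -
  have lin: "(\<lambda>p. a * s p + b * t p) \<in> spline_space d M"
    if "s \<in> spline_space d M" "t \<in> spline_space d M" for a b s t
    using that unfolding spline_space_def by (auto intro: C_dir_lincomb bidegree_poly_on_lincomb)
  have zero: "(\<lambda>p. 0) \<in> spline_space d M"
    unfolding spline_space_def C_dir_def bidegree_poly_on_def
    by (auto intro!: exI[of _ "\<lambda>_ _. 0 :: real"])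
  show ?thesis
    unfolding real_fun.subspace_def zero_fun_def plus_fun_def
  proof (intro conjI ballI allI)
    fix s t assume "s \<in> spline_space d M" "t \<in> spline_space d M"
    then show "(\<lambda>p. s p + t p) \<in> spline_space d M"
      using lin[of s t 1 1] by simp
  next
    fix s and c :: real assume "s \<in> spline_space d M"
    then show "(\<lambda>p. c * s p) \<in> spline_space d M"
      using lin[of s s c 0] by simp
  qed (rule zero)
qed

lemma sum_fun_apply: "(\<Sum>x\<in>X. F x) p = (\<Sum>x\<in>X. F x p)"
  for F :: "'x \<Rightarrow> real \<times> real \<Rightarrow> real"
  by (induction X rule: infinite_finite_induct) auto

lemma spline_space_finite_dim:
  assumes "finite M"
  shows "\<exists>B. finite B \<and> spline_space d M \<subseteq> real_fun.span B"
proof -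
  define pick where "pick p = (SOME K. K \<in> M \<and> p \<in> K)" for p :: "real \<times> real"
  define b where "b = (\<lambda>(K, i, j) p. if p \<in> \<Union>M \<and> pick p = K then fst p ^ i * snd p ^ j else 0 :: real)"
  define B where "B = b ` (M \<times> {..d} \<times> {..d})"
  have pick: "pick p \<in> M \<and> p \<in> pick p" if "p \<in> \<Union>M" for p
    unfolding pick_def by (rule someI_ex) (use that in blast)
  have "s \<in> real_fun.span B" if s: "s \<in> spline_space d M" for s
  proof -
    have "\<forall>K\<in>M. \<exists>a. \<forall>(x, y)\<in>K. s (x, y) = (\<Sum>i\<le>d. \<Sum>j\<le>d. a i j * x ^ i * y ^ j)"
      using s unfolding spline_space_def bidegree_poly_on_def by blast
    from bchoice[OF this] obtain a where
      a: "\<forall>K\<in>M. \<forall>(x, y)\<in>K. s (x, y) = (\<Sum>i\<le>d. \<Sum>j\<le>d. a K i j * x ^ i * y ^ j)"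
      by (rule exE)
    have eq: "s p = (\<Sum>K\<in>M. \<Sum>i\<le>d. \<Sum>j\<le>d. a K i j * b (K, i, j) p)" for p
    proof (cases "p \<in> \<Union>M")
      case False
      moreover have "s p = 0"
        using s False unfolding spline_space_def by blast
      ultimately show ?thesis by (simp add: b_def)
    next
      case True
      have "(\<Sum>K\<in>M. \<Sum>i\<le>d. \<Sum>j\<le>d. a K i j * b (K, i, j) p) =
          (\<Sum>K\<in>M. if K = pick p then \<Sum>i\<le>d. \<Sum>j\<le>d. a K i j * (fst p ^ i * snd p ^ j) else 0)"
        using True by (intro sum.cong[OF refl]) (simp add: b_def)
      also have "\<dots> = s p"
        using pick[OF True] bspec[OF bspec[OF a], of "pick p" p] assms
        by (simp add: case_prod_unfold mult.assoc)
      finally show ?thesis by simp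
    qed
    have "s = (\<Sum>K\<in>M. \<Sum>i\<le>d. \<Sum>j\<le>d. (\<lambda>p. a K i j * b (K, i, j) p))"
      by (rule ext) (simp only: sum_fun_apply eq)
    moreover have "(\<lambda>p. a K i j * b (K, i, j) p) \<in> real_fun.span B"
      if "K \<in> M" "i \<in> {..d}" "j \<in> {..d}" for K i j
    proof -
      have "b (K, i, j) \<in> real_fun.span B"
        using that unfolding B_def by (intro real_fun.span_base imageI SigmaI)
      then show ?thesis
        by (rule real_fun.span_scale[where c = "a K i j" and x = "b (K, i, j)"])
    qed
    then have "(\<Sum>K\<in>M. \<Sum>i\<le>d. \<Sum>j\<le>d. (\<lambda>p. a K i j * b (K, i, j) p)) \<in> real_fun.span B"
      by (simp only: real_fun.span_sum)
    ultimately show ?thesis by (simp only:)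
  qed
  moreover have "finite B" using assms by (simp add: B_def)
  ultimately show ?thesis by blast
qed

end

theory Submission
  imports Defs
begin

text \<open>
  The dimension is bounded by exhibiting finitely many linear functionals on the spline space that
  vanish together only on the zero spline (the idea behind the smoothing cofactor method).

  Let \<open>p = (x0, y0)\<close> be an interior point. The cells that meet the four quadrants at \<open>p\<close> carry four
  polynomials. Smoothness of order \<open>d - 1\<close> in \<open>y\<close> makes the upper and the lower one on the same side of
  \<open>p\<close> differ by \<open>q x * (y - y0) ^ d\<close>, where the polynomial \<open>q\<close> has degree at most \<open>d\<close>: the \<open>kink\<close> of
  the spline across the horizontal line through \<open>p\<close>. Smoothness in \<open>x\<close> makes the kinks to the right
  and to the left of \<open>p\<close> differ by a number times \<open>(x - x0) ^ d\<close>. This number, the \<open>cofactor\<close> of \<open>p\<close>,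
  is the same for the vertical line, and it is \<open>0\<close> unless \<open>p\<close> is a vertex. So along an l-edge the kink is
  a running sum of terms \<open>cofactor v * (x - x v) ^ d\<close> (lemma \<open>kink_telescope\<close>), and beyond an end
  inside the domain it vanishes. Therefore the kinks are known from the cofactors and, for each
  cross-cut, one polynomial of degree \<open>d\<close> (lemma \<open>kinks_vanish\<close>); and the interior of the domain
  being connected, the spline is known from its kinks and its polynomial on one cell (lemma
  \<open>cells_agree\<close>). These are \<open>(d + 1)\<^sup>2 + c (d + 1) + n\<^sub>v\<close> numbers.

  Some of the cofactors are redundant. On a T l-edge the running sum starts and ends with \<open>0\<close>, so its
  terms add up to \<open>0\<close>; powers \<open>(x - t) ^ d\<close> with at most \<open>d + 1\<close> distinct \<open>t\<close> are linearly
  independent, so any \<open>d + 1\<close> cofactors on the edge follow from the remaining ones on it (lemma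
  \<open>cofactors_vanish\<close>). If the T l-edges are treated one after the other, each edge saves as many cofactors
  as it has vertices off the edges before it, but at most \<open>d + 1\<close> (lemmas \<open>pivots_exist\<close> and
  \<open>dim_spline_space_le\<close>). Take the edges of the CNDC first, in the reverse of an ordering \<open>\<pi>\<close> that attains
  the minimum, and then the other T l-edges in a reasonable order. Each of the latter saves \<open>d + 1\<close>. An
  edge \<open>l\<close> of the CNDC keeps all its vertices except the multi-vertices shared with edges that follow it
  in \<open>\<pi>\<close>. Since no two parallel l-edges meet, these are not shared with edges that precede it,
  so at least \<open>n(l) - m(l) + u\<^sup>-(l)\<close> vertices are kept, and what is lacking from \<open>d + 1\<close> is at most the
  summand of \<open>l\<close> in the bound.

  Everything along l-edges is proved for horizontal ones and transferred to vertical ones by transposing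
  the mesh.
\<close>

section \<open>Polynomials of bounded degree\<close>

definition poly_fun :: "nat \<Rightarrow> (real \<Rightarrow> real) \<Rightarrow> bool" where
  "poly_fun d f \<longleftrightarrow> (\<exists>p. degree p \<le> d \<and> (\<forall>x. f x = poly p x))"

lemma poly_fun_sum: "poly_fun d (\<lambda>x. \<Sum>i\<le>d. c i * x ^ i)"
  unfolding poly_fun_def
  by (intro exI[of _ "\<Sum>i\<le>d. monom (c i) i"] conjI degree_sum_le allI)
     (auto simp: poly_sum poly_monom intro: order.trans[OF degree_monom_le])

lemma poly_fun_lincomb:
  assumes "poly_fun d f" "poly_fun d g"
  shows "poly_fun d (\<lambda>x. a * f x + b * g x)"
proof -
  from assms obtain p q where "degree p \<le> d" "degree q \<le> d" "\<forall>x. f x = poly p x" "\<forall>x. g x = poly q x"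
    unfolding poly_fun_def by blast
  then show ?thesis
    unfolding poly_fun_def
    by (intro exI[of _ "smult a p + smult b q"]) (auto intro!: degree_add_le order.trans[OF degree_smult_le])
qed

lemma poly_fun_minus: "poly_fun d f \<Longrightarrow> poly_fun d g \<Longrightarrow> poly_fun d (\<lambda>x. f x - g x)"
  using poly_fun_lincomb[of d f g 1 "- 1"] by simp

lemma poly_fun_scale: "poly_fun d f \<Longrightarrow> poly_fun d (\<lambda>x. f x * c)"
  using poly_fun_lincomb[of d f f c 0] by (simp add: mult.commute)

lemma poly_fun_zero_infinite:
  assumes "poly_fun d f" "infinite A" "\<And>x. x \<in> A \<Longrightarrow> f x = 0"
  shows "f x = 0"
proof -
  from assms(1) obtain p where p: "\<forall>x. f x = poly p x"
    unfolding poly_fun_def by blast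
  have "infinite {x. poly p x = 0}"
    using infinite_super[of A "{x. poly p x = 0}"] assms(2,3) p by auto
  then have "p = 0"
    using poly_roots_finite by blast
  with p show ?thesis by simp
qed

lemma poly_fun_zero_nat:
  assumes "poly_fun d f" "\<And>k. k \<le> d \<Longrightarrow> f (real k) = 0"
  shows "f x = 0"
proof -
  from assms(1) obtain p where p: "degree p \<le> d" "\<forall>x. f x = poly p x"
    unfolding poly_fun_def by blast
  have "p = 0"
  proof (rule ccontr)
    assume "p \<noteq> 0"
    have "d + 1 = card (real ` {..d})"
      by (simp add: card_image)
    also have "\<dots> \<le> card {x. poly p x = 0}"
      using assms(2) p(2) by (intro card_mono poly_roots_finite[OF \<open>p \<noteq> 0\<close>]) auto
    also have "\<dots> \<le> d"
      using card_poly_roots_bound[OF \<open>p \<noteq> 0\<close>] p(1) by simp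
    finally show False by simp
  qed
  with p show ?thesis by simp
qed

text \<open>
  Only the univariate sections are constrained. This is all that testing for zero on a product set
  takes, and it spares the handling of coefficients.
\<close>

definition bipoly :: "nat \<Rightarrow> (real \<Rightarrow> real \<Rightarrow> real) \<Rightarrow> bool" where
  "bipoly d f \<longleftrightarrow> (\<forall>y. poly_fun d (\<lambda>x. f x y)) \<and> (\<forall>x. poly_fun d (f x))"

lemma bipoly_zero_infinite:
  assumes "bipoly d f" "infinite A" "infinite B" "\<And>x y. x \<in> A \<Longrightarrow> y \<in> B \<Longrightarrow> f x y = 0"
  shows "f x y = 0"
proof -
  have "f x' y = 0" if "x' \<in> A" for x'
    using assms that unfolding bipoly_def by (intro poly_fun_zero_infinite[of d "f x'" B y]) auto
  then show ?thesis
    using assms unfolding bipoly_def by (intro poly_fun_zero_infinite[of d "\<lambda>x. f x y" A x]) auto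
qed

lemma bipoly_zero_nat:
  assumes "bipoly d f" "\<And>i j. i \<le> d \<Longrightarrow> j \<le> d \<Longrightarrow> f (real i) (real j) = 0"
  shows "f x y = 0"
proof -
  have "f (real i) y = 0" if "i \<le> d" for i
    using assms that unfolding bipoly_def by (intro poly_fun_zero_nat[of d "f (real i)" y]) auto
  then show ?thesis
    using assms unfolding bipoly_def by (intro poly_fun_zero_nat[of d "\<lambda>x. f x y" x]) auto
qed

lemma bipoly_lincomb: "bipoly d f \<Longrightarrow> bipoly d g \<Longrightarrow> bipoly d (\<lambda>x y. a * f x y + b * g x y)"
  unfolding bipoly_def by (auto intro: poly_fun_lincomb)

lemma bipoly_minus: "bipoly d f \<Longrightarrow> bipoly d g \<Longrightarrow> bipoly d (\<lambda>x y. f x y - g x y)"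
  using bipoly_lincomb[of d f g 1 "- 1"] by simp

lemma bipoly_eq_on_box:
  assumes "bipoly d f" "bipoly d g" "a < b" "c < e"
    and "\<And>x y. a \<le> x \<Longrightarrow> x \<le> b \<Longrightarrow> c \<le> y \<Longrightarrow> y \<le> e \<Longrightarrow> f x y = g x y"
  shows "f x y = g x y"
proof -
  have "f x y - g x y = 0"
    by (rule bipoly_zero_infinite[OF bipoly_minus[OF assms(1,2)], of "{a..b}" "{c..e}"])
       (use assms(3-5) infinite_Icc in auto)
  then show ?thesis by simp
qed

lemma bipoly_sum: "bipoly d (\<lambda>x y. \<Sum>i\<le>d. \<Sum>j\<le>d. a i j * x ^ i * y ^ j)"
proof -
  have "poly_fun d (\<lambda>x. \<Sum>i\<le>d. (\<Sum>j\<le>d. a i j * y ^ j) * x ^ i)" for y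
    by (rule poly_fun_sum)
  moreover have "poly_fun d (\<lambda>y. \<Sum>j\<le>d. (\<Sum>i\<le>d. a i j * x ^ i) * y ^ j)" for x
    by (rule poly_fun_sum)
  moreover have "(\<Sum>i\<le>d. (\<Sum>j\<le>d. a i j * y ^ j) * x ^ i) = (\<Sum>i\<le>d. \<Sum>j\<le>d. a i j * x ^ i * y ^ j)" for x y
    by (simp add: sum_distrib_left sum_distrib_right mult_ac)
  moreover have "(\<Sum>j\<le>d. (\<Sum>i\<le>d. a i j * x ^ i) * y ^ j) = (\<Sum>i\<le>d. \<Sum>j\<le>d. a i j * x ^ i * y ^ j)" for x y
    by (subst sum.swap) (simp add: sum_distrib_left sum_distrib_right mult_ac)
  ultimately show ?thesis
    unfolding bipoly_def by simp
qed

text \<open>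
  A Taylor expansion at \<open>a\<close> without its first \<open>n\<close> terms. The induction integrates the expansion of the
  derivative; the constant of integration is fixed by the zero at \<open>a\<close>.
\<close>

lemma poly_shifted_monomial:
  fixes p :: "real poly"
  assumes "degree p \<le> n" "\<And>i. i < n \<Longrightarrow> poly ((pderiv ^^ i) p) a = 0"
  shows "\<exists>c. p = smult c ([:-a, 1:] ^ n)"
  using assms
proof (induction n arbitrary: p)
  case 0
  then obtain c where "p = [:c:]"
    using degree_0_id by (metis le_zero_eq)
  then show ?case by (intro exI[of _ c]) simp
next
  case (Suc n)
  have "poly ((pderiv ^^ i) (pderiv p)) a = 0" if "i < n" for i
    using Suc.prems(2)[of "Suc i"] that by (simp add: funpow_swap1 del: funpow.simps(2) add: funpow_Suc_right)
  moreover have "degree (pderiv p) \<le> n"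
    using Suc.prems(1) by (simp add: degree_pderiv)
  ultimately obtain c where c: "pderiv p = smult c ([:-a, 1:] ^ n)"
    using Suc.IH by blast
  define q where "q = p - smult (c / real (Suc n)) ([:-a, 1:] ^ Suc n)"
  have "pderiv q = 0"
    unfolding q_def pderiv_diff pderiv_smult pderiv_power_Suc c by (simp add: pderiv_pCons)
  then obtain e where e: "q = [:e:]"
    using pderiv_iszero by blast
  have "poly q a = 0"
    using Suc.prems(2)[of 0] by (simp add: q_def)
  with e have "q = 0" by simp
  then show ?case
    unfolding q_def by (intro exI[of _ "c / real (Suc n)"]) simp
qed

text \<open>
  Differentiating the relation gives one of degree \<open>d\<close>. Subtracting \<open>x - t v\<close> times the latter from the
  original relation removes the term of \<open>v\<close> and multiplies the others by nonzero constants, which leaves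
  a shorter relation of lower degree.
\<close>

lemma shifted_powers_independent:
  fixes c t :: "'i \<Rightarrow> real"
  assumes "finite Q" "card Q \<le> d + 1" "inj_on t Q" "\<And>x. (\<Sum>v\<in>Q. c v * (x - t v) ^ d) = 0" "v \<in> Q"
  shows "c v = 0"
  using assms
proof (induction d arbitrary: Q c v)
  case 0
  then have "Q = {v}"
    using card_le_Suc0_iff_eq[of Q] by auto
  with 0(4)[of 0] show ?case by simp
next
  case (Suc d)
  have deriv: "(\<Sum>u\<in>Q. c u * (x - t u) ^ d) = 0" for x
  proof -
    have "((\<lambda>x. \<Sum>u\<in>Q. c u * (x - t u) ^ Suc d) has_real_derivative
        (\<Sum>u\<in>Q. c u * (real (Suc d) * (x - t u) ^ d))) (at x)"
    proof (rule DERIV_sum)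
      fix u
      have "((\<lambda>x. (x - t u) ^ Suc d) has_real_derivative real (Suc d) * (x - t u) ^ d) (at x)"
        by (rule derivative_eq_intros refl | simp)+
      then show "((\<lambda>x. c u * (x - t u) ^ Suc d) has_real_derivative
          c u * (real (Suc d) * (x - t u) ^ d)) (at x)"
        by (rule DERIV_cmult)
    qed
    moreover have "((\<lambda>x. \<Sum>u\<in>Q. c u * (x - t u) ^ Suc d) has_real_derivative 0) (at x)"
      using Suc.prems(4) by simp
    ultimately have "(\<Sum>u\<in>Q. c u * (real (Suc d) * (x - t u) ^ d)) = 0"
      by (rule DERIV_unique)
    also have "(\<Sum>u\<in>Q. c u * (real (Suc d) * (x - t u) ^ d)) = real (Suc d) * (\<Sum>u\<in>Q. c u * (x - t u) ^ d)"
      by (simp add: sum_distrib_left mult_ac)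
    finally show ?thesis by simp
  qed
  have other: "c u = 0" if "u \<in> Q" "u \<noteq> v" for u
  proof -
    have "(\<Sum>w\<in>Q - {v}. (c w * (t v - t w)) * (x - t w) ^ d) = 0" for x
    proof -
      have "(\<Sum>w\<in>Q. (c w * (t v - t w)) * (x - t w) ^ d) =
          (\<Sum>w\<in>Q. c w * (x - t w) ^ Suc d) - (x - t v) * (\<Sum>w\<in>Q. c w * (x - t w) ^ d)"
        by (simp add: sum_distrib_left sum_subtractf[symmetric] algebra_simps)
      also have "\<dots> = 0"
        using Suc.prems(4) deriv by simp
      finally show ?thesis
        using Suc.prems(1,5) by (simp add: sum.remove[of Q v])
    qed
    then have "c u * (t v - t u) = 0"
      using Suc.prems that
      by (intro Suc.IH[of "Q - {v}" "\<lambda>w. c w * (t v - t w)" u]) (auto intro: inj_on_subset)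
    moreover have "t v \<noteq> t u"
      using Suc.prems(3,5) that by (auto dest: inj_onD)
    ultimately show ?thesis by simp
  qed
  have "(\<Sum>w\<in>Q. c w * ((t v + 1) - t w) ^ Suc d) = c v"
    using Suc.prems(1,5) other by (subst sum.remove[of Q v]) auto
  with Suc.prems(4)[of "t v + 1"] show ?case by simp
qed

section \<open>The cells around a point\<close>

text \<open>
  The interval \<open>[a, b]\<close> contains the points next to \<open>x\<close> on the right (\<open>\<sigma> = True\<close>) or on the left
  (\<open>\<sigma> = False\<close>). Half-open conditions make the cell that meets a given quadrant unique, even at
  vertices and on edges.
\<close>

definition germ_in :: "bool \<Rightarrow> real \<Rightarrow> real \<Rightarrow> real \<Rightarrow> bool" where
  "germ_in \<sigma> x a b \<longleftrightarrow> (if \<sigma> then a \<le> x \<and> x < b else a < x \<and> x \<le> b)"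

definition quadrant :: "(real \<times> real) set set \<Rightarrow> bool \<Rightarrow> bool \<Rightarrow> real \<times> real \<Rightarrow> (real \<times> real) set \<Rightarrow> bool"
  where "quadrant M \<sigma> \<tau> p K \<longleftrightarrow> K \<in> M \<and>
    (\<exists>a b c e. K = cbox (a, c) (b, e) \<and> germ_in \<sigma> (fst p) a b \<and> germ_in \<tau> (snd p) c e)"

definition step :: "bool \<Rightarrow> real" where
  "step \<sigma> = (if \<sigma> then 1 else - 1)"

lemma germ_in_mem: "germ_in \<sigma> x a b \<Longrightarrow> a \<le> x \<and> x \<le> b \<and> a < b"
  by (auto simp: germ_in_def split: if_splits)

lemma eventually_germ_in:
  assumes "germ_in \<sigma> x a b"
  shows "eventually (\<lambda>\<epsilon>. a < x + step \<sigma> * \<epsilon> \<and> x + step \<sigma> * \<epsilon> < b) (at_right 0)"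
proof (cases \<sigma>)
  case True
  then show ?thesis
    using assms eventually_at_right_real[of 0 "b - x"]
    by (auto simp: germ_in_def step_def elim!: eventually_mono)
next
  case False
  then show ?thesis
    using assms eventually_at_right_real[of 0 "x - a"]
    by (auto simp: germ_in_def step_def elim!: eventually_mono)
qed

text \<open>
  Since a closed interval is convex, it suffices that it contains points arbitrarily close to \<open>x\<close> on the side \<open>\<sigma>\<close>.
  This is what the pigeonhole principle provides for a finite cover.
\<close>

lemma frequently_germ_in:
  assumes "frequently (\<lambda>\<epsilon>. a \<le> x + step \<sigma> * \<epsilon> \<and> x + step \<sigma> * \<epsilon> \<le> b) (at_right 0)"
  shows "germ_in \<sigma> x a b"
proof (rule ccontr)
  assume "\<not> germ_in \<sigma> x a b"
  moreover have "eventually (\<lambda>\<epsilon>. \<epsilon> > (0::real)) (at_right 0)"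
    by (rule eventually_at_right_less)
  moreover have "eventually (\<lambda>\<epsilon>. \<epsilon> < r) (at_right (0::real))" if "r > 0" for r :: real
    using eventually_at_right_real[OF that] by (auto elim: eventually_mono)
  ultimately have "eventually (\<lambda>\<epsilon>. \<not> (a \<le> x + step \<sigma> * \<epsilon> \<and> x + step \<sigma> * \<epsilon> \<le> b)) (at_right 0)"
  proof (cases "\<sigma>")
    case True
    show ?thesis
    proof (cases "a \<le> x")
      case True
      then have "b \<le> x" using \<open>\<sigma>\<close> \<open>\<not> germ_in \<sigma> x a b\<close> by (auto simp: germ_in_def)
      then show ?thesis
        using \<open>\<sigma>\<close> by (intro eventually_mono[OF eventually_at_right_less[of 0]]) (auto simp: step_def)
    next
      case False
      then show ?thesis
        using \<open>\<sigma>\<close> eventually_at_right_real[of 0 "a - x"]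
        by (auto simp: step_def elim!: eventually_mono)
    qed
  next
    case False
    show ?thesis
    proof (cases "x \<le> b")
      case True
      then have "x \<le> a" using \<open>\<not> \<sigma>\<close> \<open>\<not> germ_in \<sigma> x a b\<close> by (auto simp: germ_in_def)
      then show ?thesis
        using \<open>\<not> \<sigma>\<close> by (intro eventually_mono[OF eventually_at_right_less[of 0]]) (auto simp: step_def)
    next
      case False
      then show ?thesis
        using \<open>\<not> \<sigma>\<close> eventually_at_right_real[of 0 "x - b"]
        by (auto simp: step_def elim!: eventually_mono)
    qed
  qed
  with assms show False
    by (simp add: frequently_def)
qed

lemma germ_in_overlap:
  assumes "germ_in \<sigma> x a b" "germ_in \<sigma> x a' b'"
  shows "max a a' < min b b'"
  using assms by (auto simp: germ_in_def split: if_splits)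

text \<open>
  The combinatorial content of a T-mesh. It is visibly preserved under transposition, and the closedness of the
  finitely many cells turns statements about arbitrarily near points into statements about cells.
\<close>

locale box_mesh =
  fixes M :: "(real \<times> real) set set"
  assumes fin: "finite M"
    and boxes: "\<And>K. K \<in> M \<Longrightarrow> \<exists>a b c e. a < b \<and> c < e \<and> K = cbox (a, c) (b, e)"
    and nonoverlapping: "\<And>K K'. K \<in> M \<Longrightarrow> K' \<in> M \<Longrightarrow> interior K \<inter> interior K' \<noteq> {} \<Longrightarrow> K = K'"

lemma box_mesh_T_mesh:
  assumes "T_mesh M"
  shows "box_mesh M"
proof
  from assms have div: "M division_of \<Union>M" and int: "\<And>K. K \<in> M \<Longrightarrow> interior K \<noteq> {}"
    by (auto simp: T_mesh_def)
  then show "finite M" by blast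
  show "\<exists>a b c e. a < b \<and> c < e \<and> K = cbox (a, c) (b, e)" if K: "K \<in> M" for K
  proof -
    obtain u v where uv: "K = cbox u v"
      using division_ofD(4)[OF div K] by blast
    obtain p where "p \<in> box u v"
      using int[OF K] uv by (auto simp: interior_cbox)
    then have "fst u < fst v" "snd u < snd v"
      by (cases u; cases v; cases p; auto simp: box_def Basis_prod_def; fail)+
    then show ?thesis
      using uv by (intro exI[of _ "fst u"] exI[of _ "fst v"] exI[of _ "snd u"] exI[of _ "snd v"]) simp
  qed
  show "K = K'" if "K \<in> M" "K' \<in> M" "interior K \<inter> interior K' \<noteq> {}" for K K'
    using division_ofD(5)[OF div] that by blast
qed

lemma mem_box_pair: "(x, y) \<in> box (a, c) (b, e) \<longleftrightarrow> a < x \<and> x < b \<and> c < y \<and> y < (e::real)"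
  for a b c x y :: real
  by (auto simp: box_def Basis_prod_def)

lemma cbox_pair_inject:
  fixes a b c e :: real
  assumes "cbox (a, c) (b, e) = cbox (a', c') (b', e')" "a < b" "c < e"
  shows "a = a' \<and> b = b' \<and> c = c' \<and> e = e'"
proof -
  have "(a, c) \<in> cbox (a', c') (b', e')" "(b, e) \<in> cbox (a', c') (b', e')"
    using assms by (simp_all add: assms(1)[symmetric])
  moreover from this have "(a', c') \<in> cbox (a, c) (b, e)" "(b', e') \<in> cbox (a, c) (b, e)"
    unfolding assms(1) by auto
  ultimately show ?thesis by auto
qed

context box_mesh
begin

lemma quadrantI:
  assumes "cbox (a, c) (b, e) \<in> M" "germ_in \<sigma> (fst p) a b" "germ_in \<tau> (snd p) c e"
  shows "quadrant M \<sigma> \<tau> p (cbox (a, c) (b, e))"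
  unfolding quadrant_def using assms by blast

lemma quadrant_mem:
  assumes "quadrant M \<sigma> \<tau> p K"
  shows "K \<in> M" "p \<in> K"
  using assms by (cases p; auto simp: quadrant_def dest!: germ_in_mem)+

lemma quadrant_unique:
  assumes "quadrant M \<sigma> \<tau> p K" "quadrant M \<sigma> \<tau> p K'"
  shows "K = K'"
proof -
  from assms(1) obtain a b c e where
    K: "K \<in> M" "K = cbox (a, c) (b, e)" "germ_in \<sigma> (fst p) a b" "germ_in \<tau> (snd p) c e"
    unfolding quadrant_def by blast
  from assms(2) obtain a' b' c' e' where
    K': "K' \<in> M" "K' = cbox (a', c') (b', e')" "germ_in \<sigma> (fst p) a' b'" "germ_in \<tau> (snd p) c' e'"
    unfolding quadrant_def by blast
  obtain x where x: "max a a' < x" "x < min b b'"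
    using germ_in_overlap[OF K(3) K'(3)] dense by blast
  obtain y where y: "max c c' < y" "y < min e e'"
    using germ_in_overlap[OF K(4) K'(4)] dense by blast
  have "(x, y) \<in> interior K \<inter> interior K'"
    unfolding K(2) K'(2) interior_cbox using x y by (simp add: mem_box_pair)
  then show ?thesis
    using nonoverlapping[OF K(1) K'(1)] by blast
qed

text \<open>
  The diagonal ray into the quadrant stays in the domain for a while. As there are finitely many cells,
  one of them contains points of the ray arbitrarily close to \<open>p\<close>.
\<close>

lemma quadrant_exists:
  assumes "p \<in> interior (\<Union>M)"
  shows "\<exists>K. quadrant M \<sigma> \<tau> p K"
proof -
  define g where "g \<epsilon> = (fst p + step \<sigma> * \<epsilon>, snd p + step \<tau> * \<epsilon>)" for \<epsilon> :: real
  have "(g \<longlongrightarrow> g 0) (at_right 0)"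
    unfolding g_def by (intro tendsto_intros)
  moreover have "g 0 = p"
    by (simp add: g_def)
  ultimately have "eventually (\<lambda>\<epsilon>. g \<epsilon> \<in> interior (\<Union>M)) (at_right 0)"
    using assms by (auto dest: topological_tendstoD)
  then have "eventually (\<lambda>\<epsilon>. \<exists>K\<in>M. g \<epsilon> \<in> K) (at_right 0)"
    using interior_subset[of "\<Union>M"] by (auto elim!: eventually_mono)
  then have "frequently (\<lambda>\<epsilon>. \<exists>K\<in>M. g \<epsilon> \<in> K) (at_right 0)"
    by (rule eventually_frequently[rotated]) simp
  then obtain K where K: "K \<in> M" "frequently (\<lambda>\<epsilon>. g \<epsilon> \<in> K) (at_right 0)"
    using frequently_bex_finite[OF fin, of "\<lambda>\<epsilon> K. g \<epsilon> \<in> K"] by blast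
  obtain a b c e where abce: "K = cbox (a, c) (b, e)"
    using boxes[OF K(1)] by blast
  have "germ_in \<sigma> (fst p) a b"
    by (rule frequently_germ_in, rule frequently_mono[OF _ K(2)]) (auto simp: abce g_def)
  moreover have "germ_in \<tau> (snd p) c e"
    by (rule frequently_germ_in, rule frequently_mono[OF _ K(2)]) (auto simp: abce g_def)
  ultimately show ?thesis
    using K(1) abce unfolding quadrant_def by blast
qed

text \<open>
  The four cells contain a box around \<open>p\<close>, whose sides are the nearest ones of the cells.
\<close>

lemma interior_if_quadrants:
  assumes "\<And>\<sigma> \<tau>. \<exists>K. quadrant M \<sigma> \<tau> p K"
  shows "p \<in> interior (\<Union>M)"
proof -
  have "\<exists>a b c e. cbox (a, c) (b, e) \<in> M \<and> germ_in \<sigma> (fst p) a b \<and> germ_in \<tau> (snd p) c e" for \<sigma> \<tau>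
    using assms[of \<sigma> \<tau>] unfolding quadrant_def by blast
  then obtain A B C E where q: "\<And>\<sigma> \<tau>. cbox (A \<sigma> \<tau>, C \<sigma> \<tau>) (B \<sigma> \<tau>, E \<sigma> \<tau>) \<in> M"
    "\<And>\<sigma> \<tau>. germ_in \<sigma> (fst p) (A \<sigma> \<tau>) (B \<sigma> \<tau>)" "\<And>\<sigma> \<tau>. germ_in \<tau> (snd p) (C \<sigma> \<tau>) (E \<sigma> \<tau>)"
    by metis
  let ?O = "box (max (A False True) (A False False), max (C True False) (C False False))
     (min (B True True) (B True False), min (E True True) (E False True))"
  have "p \<in> ?O"
    using q(2)[of True] q(2)[of False] q(3)[of True] q(3)[of False]
    by (cases p) (auto simp: mem_box_pair germ_in_def)
  moreover have "?O \<subseteq> \<Union>M"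
  proof
    fix z assume z: "z \<in> ?O"
    define \<sigma> where "\<sigma> \<longleftrightarrow> fst p \<le> fst z"
    define \<tau> where "\<tau> \<longleftrightarrow> snd p \<le> snd z"
    have "z \<in> cbox (A \<sigma> \<tau>, C \<sigma> \<tau>) (B \<sigma> \<tau>, E \<sigma> \<tau>)"
      using z q(2)[of \<sigma> \<tau>] q(3)[of \<tau> \<sigma>]
      by (cases z; cases \<sigma>; cases \<tau>) (auto simp: mem_box_pair germ_in_def \<sigma>_def \<tau>_def)
    then show "z \<in> \<Union>M"
      using q(1) by blast
  qed
  ultimately show ?thesis
    using interior_maximal[OF _ open_box] by blast
qed

lemma quadrant_of_mem:
  assumes "K \<in> M" "p \<in> K"
  shows "\<exists>\<sigma> \<tau>. quadrant M \<sigma> \<tau> p K"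
proof -
  obtain a b c e where abce: "a < b" "c < e" "K = cbox (a, c) (b, e)"
    using boxes[OF assms(1)] by blast
  have "germ_in (fst p < b) (fst p) a b" "germ_in (snd p < e) (snd p) c e"
    using assms(2) abce by (cases p; auto simp: germ_in_def)+
  then show ?thesis
    using assms(1) abce(3) unfolding quadrant_def by blast
qed

lemma finite_vertices: "finite (vertices M)"
proof -
  have "\<forall>K\<in>M. \<exists>u v. K = cbox u v"
    using boxes by blast
  then obtain u v where uv: "\<And>K. K \<in> M \<Longrightarrow> K = cbox (u K) (v K)"
    by metis
  have "vertices M \<subseteq> (\<Union>K\<in>M. {fst (u K), fst (v K)} \<times> {snd (u K), snd (v K)})"
  proof
    fix p assume "p \<in> vertices M"
    then obtain a b where ab: "cbox a b \<in> M" "fst p \<in> {fst a, fst b}" "snd p \<in> {snd a, snd b}"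
      unfolding vertices_def by auto
    obtain K where K: "K = cbox a b" by blast
    have "K \<noteq> {}"
      using boxes[of K] ab(1) K by force
    moreover have "cbox a b = cbox (u K) (v K)"
      using uv[of K] ab(1) unfolding K by blast
    ultimately have "a = u K \<and> b = v K"
      unfolding K using eq_cbox by blast
    then have "p \<in> {fst (u K), fst (v K)} \<times> {snd (u K), snd (v K)}"
      using ab(2,3) by (simp only: mem_Times_iff)
    then show "p \<in> (\<Union>K\<in>M. {fst (u K), fst (v K)} \<times> {snd (u K), snd (v K)})"
      using ab(1) K by blast
  qed
  then show ?thesis
    by (rule finite_subset) (use fin in auto)
qed

lemma corner_vertex:
  assumes "cbox (a, c) (b, e) \<in> M" "x \<in> {a, b}" "y \<in> {c, e}"
  shows "(x, y) \<in> vertices M"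
  unfolding vertices_def using assms by force

end

section \<open>Horizontal edges and runs\<close>

lemma mem_closed_hseg:
  fixes u v y :: real
  assumes "u < v"
  shows "p \<in> closed_segment (u, y) (v, y) \<longleftrightarrow> u \<le> fst p \<and> fst p \<le> v \<and> snd p = y"
proof
  assume "p \<in> closed_segment (u, y) (v, y)"
  then obtain t where t: "0 \<le> t" "t \<le> 1" "p = (1 - t) *\<^sub>R (u, y) + t *\<^sub>R (v, y)"
    by (auto simp: in_segment)
  have "fst p = u + t * (v - u)" "snd p = y"
    by (simp_all add: t(3) algebra_simps)
  moreover have "0 \<le> t * (v - u)" "t * (v - u) \<le> 1 * (v - u)"
    using t assms by (auto intro!: mult_nonneg_nonneg mult_right_mono)
  ultimately show "u \<le> fst p \<and> fst p \<le> v \<and> snd p = y"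
    by simp
next
  assume p: "u \<le> fst p \<and> fst p \<le> v \<and> snd p = y"
  define t where "t = (fst p - u) / (v - u)"
  have "0 \<le> t" "t \<le> 1"
    using p assms by (simp_all add: t_def divide_le_eq_1)
  moreover have "t * (v - u) = fst p - u"
    using assms by (simp add: t_def)
  then have "p = (1 - t) *\<^sub>R (u, y) + t *\<^sub>R (v, y)"
    using p by (cases p) (simp add: algebra_simps)
  ultimately show "p \<in> closed_segment (u, y) (v, y)"
    by (auto simp: in_segment)
qed

lemma mem_open_hseg:
  fixes u v y :: real
  assumes "u < v"
  shows "p \<in> open_segment (u, y) (v, y) \<longleftrightarrow> u < fst p \<and> fst p < v \<and> snd p = y"
  unfolding open_segment_def using mem_closed_hseg[OF assms, of p y]
  by (cases p) auto

lemma hseg_eq_iff: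
  fixes u v y :: real
  assumes "u < v" "closed_segment (u, y) (v, y) = closed_segment p q"
  shows "{p, q} = {(u, y), (v, y)}" "open_segment p q = open_segment (u, y) (v, y)"
proof -
  show "{p, q} = {(u, y), (v, y)}"
    using assms(2) closed_segment_eq by blast
  then show "open_segment p q = open_segment (u, y) (v, y)"
    unfolding open_segment_def assms(2)[symmetric] by simp
qed

lemma horizontal_hseg: "u < v \<Longrightarrow> horizontal (closed_segment (u, y) (v, y))"
  unfolding horizontal_def by blast

lemma not_horizontal_and_vertical: "\<not> (horizontal l \<and> vertical l)"
proof
  assume "horizontal l \<and> vertical l"
  then obtain a b y x c e where *: "a < b" "l = closed_segment (a, y) (b, y)"
    "c < e" "l = closed_segment (x, c) (x, e)"
    unfolding horizontal_def vertical_def by blast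
  then have "(x, c) \<in> closed_segment (a, y) (b, y)" "(x, e) \<in> closed_segment (a, y) (b, y)"
    using ends_in_segment by metis+
  then show False
    using *(1,3) by (simp add: mem_closed_hseg)
qed

lemma segment_within_hseg:
  assumes "horizontal e \<or> vertical e" "e \<subseteq> closed_segment (\<alpha>, y) (\<beta>, y)" "\<alpha> < \<beta>"
  obtains u v where "u < v" "e = closed_segment (u, y) (v, y)" "\<alpha> \<le> u" "v \<le> \<beta>"
  using assms(1)
proof
  assume "horizontal e"
  then obtain a b z where e: "a < b" "e = closed_segment (a, z) (b, z)"
    unfolding horizontal_def by blast
  then have "(a, z) \<in> closed_segment (\<alpha>, y) (\<beta>, y)" "(b, z) \<in> closed_segment (\<alpha>, y) (\<beta>, y)"
    using assms(2) ends_in_segment by blast+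
  then show thesis
    using that[of a b] e assms(3) by (simp add: mem_closed_hseg)
next
  assume "vertical e"
  then obtain a b x where e: "a < b" "e = closed_segment (x, a) (x, b)"
    unfolding vertical_def by blast
  then have "(x, a) \<in> closed_segment (\<alpha>, y) (\<beta>, y)" "(x, b) \<in> closed_segment (\<alpha>, y) (\<beta>, y)"
    using assms(2) ends_in_segment by blast+
  then show thesis
    using e(1) assms(3) by (simp add: mem_closed_hseg)
qed

definition maximal_run :: "(real \<times> real) set set \<Rightarrow> (real \<times> real) set \<Rightarrow> bool" where
  "maximal_run M l \<longleftrightarrow> l \<in> interior_runs M \<and> (\<forall>l'\<in>interior_runs M. \<not> l \<subset> l')"

lemma interior_run_union:
  assumes "l \<in> interior_runs M" "l' \<in> interior_runs M" "horizontal (l \<union> l') \<or> vertical (l \<union> l')"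
  shows "l \<union> l' \<in> interior_runs M"
proof -
  from assms obtain E E' where "E \<subseteq> interior_edges M" "l = \<Union>E" "E' \<subseteq> interior_edges M" "l' = \<Union>E'"
    unfolding interior_runs_def by blast
  then have "E \<union> E' \<subseteq> interior_edges M \<and> l \<union> l' = \<Union>(E \<union> E')"
    by blast
  with assms(3) show ?thesis
    unfolding interior_runs_def by blast
qed

lemma edge_in_runs:
  assumes "e \<in> interior_edges M"
  shows "e \<in> interior_runs M"
proof -
  have "horizontal e \<or> vertical e"
    using assms unfolding interior_edges_def edges_def by blast
  moreover have "{e} \<subseteq> interior_edges M" "e = \<Union>{e}"
    using assms by auto
  ultimately show ?thesis
    unfolding interior_runs_def by blast
qed

lemma hseg_Un:
  fixes u v u' v' y :: real
  assumes "u < v" "u' < v'" "u' \<le> v" "u \<le> v'"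
  shows "closed_segment (u, y) (v, y) \<union> closed_segment (u', y) (v', y) =
    closed_segment (min u u', y) (max v v', y)"
proof -
  have "min u u' < max v v'" using assms by auto
  then show ?thesis
    using assms by (auto simp: mem_closed_hseg min_def max_def)
qed

text \<open>
  Two collinear segments with a common point unite to a longer run.
\<close>

lemma maximal_horizontal_runs_disjoint:
  assumes "maximal_run M l" "maximal_run M l'" "horizontal l" "horizontal l'" "l \<inter> l' \<noteq> {}"
  shows "l = l'"
proof -
  obtain a b y where l: "a < b" "l = closed_segment (a, y) (b, y)"
    using assms(3) unfolding horizontal_def by blast
  obtain a' b' y' where l': "a' < b'" "l' = closed_segment (a', y') (b', y')"
    using assms(4) unfolding horizontal_def by blast
  obtain p where p: "p \<in> l" "p \<in> l'" using assms(5) by blast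
  then have "y' = y" "a' \<le> b" "a \<le> b'"
    using l l' by (auto simp: mem_closed_hseg)
  then have "l \<union> l' = closed_segment (min a a', y) (max b b', y)"
    using l l' hseg_Un[of a b a' b' y] by simp
  moreover have "min a a' < max b b'" using l(1) by auto
  ultimately have "horizontal (l \<union> l')"
    using horizontal_hseg by simp
  then have "l \<union> l' \<in> interior_runs M"
    using assms(1,2) interior_run_union[of l M l'] by (simp add: maximal_run_def)
  then have "\<not> l \<subset> l \<union> l'" "\<not> l' \<subset> l \<union> l'"
    using assms(1,2) by (simp_all add: maximal_run_def)
  then show ?thesis by auto
qed

context box_mesh
begin

lemma closed_cell: "K \<in> M \<Longrightarrow> closed K"
  using boxes[of K] closed_cbox by auto

lemma frontier_cell_subset: "K \<in> M \<Longrightarrow> frontier K \<subseteq> K"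
  by (simp add: closed_cell frontier_subset_closed)

lemma closed_domain: "closed (\<Union>M)"
  using fin closed_cell by (intro closed_Union) auto

lemma finite_edges: "finite (edges M)"
proof -
  have "edges M \<subseteq> (\<lambda>(u, v). closed_segment u v) ` (vertices M \<times> vertices M)"
    unfolding edges_def by auto
  then show ?thesis
    by (rule finite_subset) (simp add: finite_vertices)
qed

lemma finite_interior_edges: "finite (interior_edges M)"
  using finite_edges unfolding interior_edges_def by simp

lemma finite_interior_runs: "finite (interior_runs M)"
proof -
  have "interior_runs M \<subseteq> Union ` Pow (interior_edges M)"
    unfolding interior_runs_def by auto
  then show ?thesis
    by (rule finite_subset) (simp add: finite_interior_edges)
qed

lemma maximal_run_exists:
  assumes "l \<in> interior_runs M"
  obtains l' where "maximal_run M l'" "l \<subseteq> l'"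
proof -
  obtain l' where "l' \<in> interior_runs M" "l \<subseteq> l'" "\<forall>k\<in>interior_runs M. l' \<subseteq> k \<longrightarrow> l' = k"
    using finite_has_maximal2[OF finite_interior_runs assms] by blast
  with that[of l'] show thesis
    unfolding maximal_run_def by blast
qed

lemma interior_edge_horizontal:
  assumes "closed_segment (u, y) (v, y) \<in> interior_edges M" "u < v"
  shows "(u, y) \<in> vertices M" "(v, y) \<in> vertices M"
    "\<And>x. u < x \<Longrightarrow> x < v \<Longrightarrow> (x, y) \<notin> vertices M"
    "\<And>x. u \<le> x \<Longrightarrow> x \<le> v \<Longrightarrow> \<exists>K\<in>M. (x, y) \<in> frontier K"
    "\<exists>x. u < x \<and> x < v \<and> (x, y) \<in> interior (\<Union>M)"
proof -
  let ?e = "closed_segment (u, y) (v, y)"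
  from assms obtain p q where pq: "?e = closed_segment p q"
    "p \<in> vertices M" "q \<in> vertices M" "open_segment p q \<inter> vertices M = {}"
    "?e \<subseteq> (\<Union>K\<in>M. frontier K)" and nf: "\<not> ?e \<subseteq> frontier (\<Union>M)"
    unfolding interior_edges_def edges_def mem_Collect_eq by metis
  note ends = hseg_eq_iff[OF assms(2) pq(1)]
  show "(u, y) \<in> vertices M" "(v, y) \<in> vertices M"
    using ends(1) pq(2,3) by (auto simp: doubleton_eq_iff)
  show "(x, y) \<notin> vertices M" if "u < x" "x < v" for x
  proof -
    have "(x, y) \<in> open_segment (u, y) (v, y)"
      using that assms(2) by (simp add: mem_open_hseg)
    then show ?thesis
      using pq(4) unfolding ends(2) by blast
  qed
  show fr: "\<exists>K\<in>M. (x, y) \<in> frontier K" if "u \<le> x" "x \<le> v" for x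
  proof -
    have "(x, y) \<in> ?e"
      using that assms(2) by (simp add: mem_closed_hseg)
    then show ?thesis
      using pq(5) by blast
  qed
  obtain q' where q': "q' \<in> ?e" "q' \<notin> frontier (\<Union>M)"
    using nf by blast
  define x where "x = fst q'"
  have x: "u \<le> x" "x \<le> v" "(x, y) \<notin> frontier (\<Union>M)"
    using q' assms(2) by (auto simp: mem_closed_hseg x_def)
  have "(x, y) \<in> \<Union>M"
    using fr[OF x(1,2)] frontier_cell_subset by blast
  then have int: "(x, y) \<in> interior (\<Union>M)"
    using x(3) closed_domain by (simp add: frontier_def)
  define \<sigma> where "\<sigma> \<longleftrightarrow> x < v"
  have \<sigma>: "germ_in \<sigma> x u v"
    using x(1,2) assms(2) by (auto simp: germ_in_def \<sigma>_def)
  have "((\<lambda>\<epsilon>. (x + step \<sigma> * \<epsilon>, y)) \<longlongrightarrow> (x + step \<sigma> * 0, y)) (at_right 0)"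
    by (intro tendsto_intros)
  then have "eventually (\<lambda>\<epsilon>. (x + step \<sigma> * \<epsilon>, y) \<in> interior (\<Union>M)) (at_right 0)"
    by (rule topological_tendstoD) (use int in simp_all)
  from eventually_happens[OF eventually_conj[OF eventually_germ_in[OF \<sigma>] this]]
  show "\<exists>x. u < x \<and> x < v \<and> (x, y) \<in> interior (\<Union>M)"
    by auto
qed

lemma interior_not_frontier:
  assumes "cbox (a, c) (b, e) \<in> M" "a < x" "x < b" "c < y" "y < e" "K \<in> M"
  shows "(x, y) \<notin> frontier K"
proof
  assume fr: "(x, y) \<in> frontier K"
  then have "(x, y) \<in> K"
    using frontier_cell_subset[OF assms(6)] by blast
  from quadrant_of_mem[OF assms(6) this] obtain \<sigma> \<tau> where "quadrant M \<sigma> \<tau> (x, y) K"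
    by blast
  moreover have "quadrant M \<sigma> \<tau> (x, y) (cbox (a, c) (b, e))"
    using assms by (intro quadrantI) (auto simp: germ_in_def)
  ultimately have "K = cbox (a, c) (b, e)"
    by (rule quadrant_unique)
  then show False
    using fr assms by (simp add: frontier_def interior_cbox mem_box_pair)
qed

text \<open>
  The cells next to an interior edge reach along the whole edge: starting from a point of the edge inside
  the domain, a cell on the \<open>\<tau>\<close>-side has a side on the line of the edge, because points of the edge lie
  on frontiers of cells. The ends of this side are vertices, so none of them is strictly inside the edge.
\<close>

lemma interior_edge_cell:
  assumes "closed_segment (u, y) (v, y) \<in> interior_edges M" "u < v"
  shows "\<exists>a b c e. cbox (a, c) (b, e) \<in> M \<and> germ_in \<tau> y c e \<and> a \<le> u \<and> v \<le> b"
proof -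
  note e = interior_edge_horizontal[OF assms]
  obtain z where z: "u < z" "z < v" "(z, y) \<in> interior (\<Union>M)"
    using e(5) by blast
  obtain a b c e where K: "cbox (a, c) (b, e) \<in> M" "germ_in True z a b" "germ_in \<tau> y c e"
    using quadrant_exists[OF z(3), of True \<tau>] unfolding quadrant_def by auto
  have "y = c \<or> y = e"
  proof (rule ccontr)
    assume "\<not> ?thesis"
    then have "c < y" "y < e"
      using germ_in_mem[OF K(3)] by auto
    obtain x where x: "z < x" "x < min b v"
      using K(2) z dense[of z "min b v"] by (auto simp: germ_in_def)
    then have "\<exists>K\<in>M. (x, y) \<in> frontier K"
      using e(4)[of x] z by simp
    then show False
      using interior_not_frontier[OF K(1)] x K(2) \<open>c < y\<close> \<open>y < e\<close> by (auto simp: germ_in_def)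
  qed
  then have "(a, y) \<in> vertices M" "(b, y) \<in> vertices M"
    using corner_vertex[OF K(1)] by auto
  then have "a \<le> u" "v \<le> b"
    using e(3)[of a] e(3)[of b] K(2) z by (auto simp: germ_in_def not_less[symmetric])
  then show ?thesis
    using K by blast
qed

text \<open>
  Points next to \<open>(x, y)\<close> on either side belong to an edge of the run, so all four quadrants at \<open>(x, y)\<close>
  are occupied by cells.
\<close>

lemma interior_run_points:
  assumes "closed_segment (\<alpha>, y) (\<beta>, y) \<in> interior_runs M" "\<alpha> < x" "x < \<beta>"
  shows "(x, y) \<in> interior (\<Union>M)"
proof (rule interior_if_quadrants)
  fix \<sigma> \<tau>
  from assms(1) obtain E where E: "E \<subseteq> interior_edges M" "closed_segment (\<alpha>, y) (\<beta>, y) = \<Union>E"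
    unfolding interior_runs_def by blast
  have "\<alpha> < \<beta>" using assms by simp
  have "germ_in \<sigma> x \<alpha> \<beta>"
    using assms by (auto simp: germ_in_def)
  from eventually_germ_in[OF this]
  have "eventually (\<lambda>\<epsilon>. \<exists>e\<in>E. (x + step \<sigma> * \<epsilon>, y) \<in> e) (at_right 0)"
  proof eventually_elim
    case (elim \<epsilon>)
    then have "(x + step \<sigma> * \<epsilon>, y) \<in> \<Union>E"
      using \<open>\<alpha> < \<beta>\<close> unfolding E(2)[symmetric] by (simp add: mem_closed_hseg)
    then show ?case by blast
  qed
  then have "frequently (\<lambda>\<epsilon>. \<exists>e\<in>E. (x + step \<sigma> * \<epsilon>, y) \<in> e) (at_right 0)"
    by (rule eventually_frequently[rotated]) simp
  then obtain e where e: "e \<in> E" "frequently (\<lambda>\<epsilon>. (x + step \<sigma> * \<epsilon>, y) \<in> e) (at_right 0)"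
    using frequently_bex_finite[OF finite_subset[OF E(1) finite_interior_edges],
      of "\<lambda>\<epsilon> e. (x + step \<sigma> * \<epsilon>, y) \<in> e"] by blast
  have "horizontal e \<or> vertical e" "e \<subseteq> closed_segment (\<alpha>, y) (\<beta>, y)"
    using e(1) E unfolding interior_edges_def edges_def by blast+
  then obtain u v where uv: "u < v" "e = closed_segment (u, y) (v, y)"
    using \<open>\<alpha> < \<beta>\<close> by (rule segment_within_hseg)
  have germ: "germ_in \<sigma> x u v"
    by (rule frequently_germ_in, rule frequently_mono[OF _ e(2)])
       (use uv in \<open>auto simp: mem_closed_hseg\<close>)
  have "e \<in> interior_edges M" using e(1) E(1) by blast
  then obtain a b c e' where "cbox (a, c) (b, e') \<in> M" "germ_in \<tau> y c e'" "a \<le> u" "v \<le> b"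
    using interior_edge_cell[of u y v] uv by blast
  moreover from this have "germ_in \<sigma> x a b"
    using germ by (auto simp: germ_in_def split: if_splits)
  ultimately show "\<exists>K. quadrant M \<sigma> \<tau> (x, y) K"
    using quadrantI[of a c b e'] by fastforce
qed

lemma horizontal_run_subset_interior:
  assumes "maximal_run M l" "horizontal l" "l = closed_segment u v" "{u, v} \<subseteq> interior (\<Union>M)"
  shows "l \<subseteq> interior (\<Union>M)"
proof
  fix p assume "p \<in> l"
  obtain \<alpha> \<beta> y where l: "\<alpha> < \<beta>" "l = closed_segment (\<alpha>, y) (\<beta>, y)"
    using assms(2) unfolding horizontal_def by blast
  have "{u, v} = {(\<alpha>, y), (\<beta>, y)}"
    using hseg_eq_iff(1)[OF l(1)] l(2) assms(3) by simp
  then have ends: "(\<alpha>, y) \<in> interior (\<Union>M)" "(\<beta>, y) \<in> interior (\<Union>M)"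
    using assms(4) by auto
  have p: "p = (fst p, y)" "\<alpha> \<le> fst p" "fst p \<le> \<beta>"
    using \<open>p \<in> l\<close> l by (auto simp: mem_closed_hseg prod_eq_iff)
  show "p \<in> interior (\<Union>M)"
  proof (cases "fst p = \<alpha> \<or> fst p = \<beta>")
    case True
    then show ?thesis using ends p(1) by metis
  next
    case False
    then have "(fst p, y) \<in> interior (\<Union>M)"
      using interior_run_points[of \<alpha> y \<beta> "fst p"] p l(2) assms(1) by (simp add: maximal_run_def)
    then show ?thesis using p(1) by simp
  qed
qed

lemma interior_run_ends:
  assumes "closed_segment (\<alpha>, y) (\<beta>, y) \<in> interior_runs M" "\<alpha> < \<beta>"
  shows "(\<alpha>, y) \<in> vertices M" "(\<beta>, y) \<in> vertices M"
    "closed_segment (\<alpha>, y) (\<beta>, y) \<subseteq> \<Union>M"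
proof -
  from assms(1) obtain E where E: "E \<subseteq> interior_edges M" "closed_segment (\<alpha>, y) (\<beta>, y) = \<Union>E"
    unfolding interior_runs_def by blast
  have edge: "\<exists>u v. u < v \<and> e = closed_segment (u, y) (v, y) \<and> \<alpha> \<le> u \<and> v \<le> \<beta>" if "e \<in> E" for e
  proof -
    have "horizontal e \<or> vertical e" "e \<subseteq> closed_segment (\<alpha>, y) (\<beta>, y)"
      using that E unfolding interior_edges_def edges_def by blast+
    then show ?thesis
      using segment_within_hseg[of e \<alpha> y \<beta>] assms(2) by metis
  qed
  have end_vertex: "(x, y) \<in> vertices M" if "(x, y) \<in> e" "e \<in> E" "x = \<alpha> \<or> x = \<beta>" for e x
  proof -
    obtain u v where uv: "u < v" "e = closed_segment (u, y) (v, y)" "\<alpha> \<le> u" "v \<le> \<beta>"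
      using edge[OF \<open>e \<in> E\<close>] by blast
    then have "x = u \<or> x = v"
      using that by (auto simp: mem_closed_hseg)
    then show ?thesis
      using interior_edge_horizontal(1,2)[of u y v] uv E(1) \<open>e \<in> E\<close> by blast
  qed
  have "(\<alpha>, y) \<in> \<Union>E" "(\<beta>, y) \<in> \<Union>E"
    unfolding E(2)[symmetric] by auto
  then show "(\<alpha>, y) \<in> vertices M" "(\<beta>, y) \<in> vertices M"
    using end_vertex by blast+
  show "closed_segment (\<alpha>, y) (\<beta>, y) \<subseteq> \<Union>M"
  proof
    fix p assume "p \<in> closed_segment (\<alpha>, y) (\<beta>, y)"
    then obtain e where e: "e \<in> E" "p \<in> e" using E(2) by blast
    obtain u v where uv: "u < v" "e = closed_segment (u, y) (v, y)"
      using edge[OF \<open>e \<in> E\<close>] by blast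
    have "e \<in> interior_edges M" using e(1) E(1) by blast
    then obtain K where "K \<in> M" "p \<in> frontier K"
      using interior_edge_horizontal(4)[of u y v "fst p"] uv e(2) by (cases p) (auto simp: mem_closed_hseg)
    then show "p \<in> \<Union>M"
      using frontier_cell_subset by blast
  qed
qed

lemma run_meets_interior:
  assumes "l \<in> interior_runs M"
  shows "l \<inter> interior (\<Union>M) \<noteq> {}"
proof -
  obtain E where E: "E \<subseteq> interior_edges M" "l = \<Union>E" "horizontal l \<or> vertical l"
    using assms unfolding interior_runs_def by blast
  have "l \<noteq> {}"
    using E(3) unfolding horizontal_def vertical_def by auto
  then obtain e where e: "e \<in> E" "e \<subseteq> l"
    using E(2) by blast
  then have "e \<in> interior_edges M"
    using E(1) by blast
  then obtain p where "p \<in> e" "p \<notin> frontier (\<Union>M)" "e \<subseteq> (\<Union>K\<in>M. frontier K)"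
    unfolding interior_edges_def edges_def by blast
  moreover from this have "p \<in> \<Union>M"
    using frontier_cell_subset by blast
  ultimately have "p \<in> interior (\<Union>M)"
    unfolding frontier_def closure_closed[OF closed_domain] by blast
  with \<open>p \<in> e\<close> e(2) show ?thesis by blast
qed

text \<open>
  If the cells above and below the line through \<open>p\<close> differ, the upper cell has its lower side on this
  line. The vertices on the line that are closest to \<open>p\<close> cut an edge out of this side, and the edge is
  interior because it contains \<open>p\<close>.
\<close>

lemma interior_edge_if_quadrants_differ:
  assumes "p \<in> interior (\<Union>M)" "quadrant M \<sigma> True p K" "quadrant M \<sigma> False p K'" "K \<noteq> K'"
  obtains u v where "u < v" "germ_in \<sigma> (fst p) u v"
    "closed_segment (u, snd p) (v, snd p) \<in> interior_edges M"
proof -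
  obtain x0 y where p: "p = (x0, y)" by (cases p)
  from assms(2) obtain a b c e where
    K: "K = cbox (a, c) (b, e)" "K \<in> M" "germ_in \<sigma> x0 a b" "germ_in True y c e"
    unfolding quadrant_def p by auto
  have "c = y"
  proof (rule ccontr)
    assume "c \<noteq> y"
    then have "germ_in False y c e"
      using K(4) by (auto simp: germ_in_def)
    then have "quadrant M \<sigma> False p K"
      unfolding quadrant_def p using K by auto
    then show False
      using quadrant_unique[OF assms(3)] assms(4) by blast
  qed
  \<comment> \<open>Split the vertices on the line into those before and those behind \<open>p\<close>, where \<open>p\<close> itself
      belongs to the part that makes \<open>[u, v]\<close> reach to the \<open>\<sigma>\<close>-side of \<open>p\<close>.\<close>
  define X where "X = {x. (x, y) \<in> vertices M}"
  have "X \<subseteq> fst ` vertices M"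
    unfolding X_def by force
  then have "finite X"
    by (rule finite_subset) (simp add: finite_vertices)
  define A where "A = {x \<in> X. if \<sigma> then x \<le> x0 else x < x0}"
  define B where "B = X - A"
  define u where "u = Max A"
  define v where "v = Min B"
  have "a \<in> X" "b \<in> X"
    unfolding X_def using corner_vertex[of a c b e] K(1,2) \<open>c = y\<close> by auto
  then have ab: "a \<in> A" "b \<in> B"
    using K(3) by (auto simp: A_def B_def germ_in_def split: if_splits)
  have finAB: "finite A" "finite B"
    using \<open>finite X\<close> by (simp_all add: A_def B_def)
  have u: "u \<in> A" "a \<le> u" and v: "v \<in> B" "v \<le> b"
    unfolding u_def v_def using ab finAB by (auto intro: Max_in Min_in)
  have between: "x \<notin> X" if "u < x" "x < v" for x
  proof
    assume "x \<in> X"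
    then have "x \<in> A \<or> x \<in> B" by (auto simp: B_def)
    then show False
      using that Max_ge[OF finAB(1), of x] Min_le[OF finAB(2), of x] by (auto simp: u_def v_def)
  qed
  have germ: "germ_in \<sigma> x0 u v"
    using u(1) v(1) by (auto simp: A_def B_def germ_in_def split: if_splits)
  then have "u < v" using germ_in_mem by blast
  let ?e = "closed_segment (u, y) (v, y)"
  have "?e \<subseteq> frontier K"
  proof
    fix q assume "q \<in> ?e"
    then show "q \<in> frontier K"
      using \<open>u < v\<close> u(2) v(2) K(4) \<open>c = y\<close> unfolding K(1)
      by (cases q) (auto simp: mem_closed_hseg frontier_def interior_cbox mem_box_pair germ_in_def)
  qed
  moreover have "(u, y) \<in> vertices M" "(v, y) \<in> vertices M"
    using u(1) v(1) by (auto simp: A_def B_def X_def)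
  moreover have "open_segment (u, y) (v, y) \<inter> vertices M = {}"
    using between \<open>u < v\<close> by (auto simp: mem_open_hseg X_def)
  ultimately have "?e \<in> edges M"
    unfolding edges_def using horizontal_hseg[OF \<open>u < v\<close>] K(2) by blast
  moreover have "p \<in> ?e"
    using germ_in_mem[OF germ] \<open>u < v\<close> p by (simp add: mem_closed_hseg)
  then have "\<not> ?e \<subseteq> frontier (\<Union>M)"
    using assms(1) by (auto simp: frontier_def)
  ultimately have "?e \<in> interior_edges M"
    unfolding interior_edges_def by blast
  with that[of u v] germ \<open>u < v\<close> p show thesis by simp
qed

end

section \<open>Kinks and cofactors along horizontal lines\<close>

definition quadrant_cell where
  "quadrant_cell M \<sigma> \<tau> p = (THE K. quadrant M \<sigma> \<tau> p K)"

text \<open>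
  The smoothing cofactor of the horizontal edge that leaves \<open>p\<close> in direction \<open>\<sigma>\<close>: the difference of
  the upper and the lower polynomial is \<open>kink M F \<sigma> p x * (y - snd p) ^ d\<close>, and the value of
  \<open>(y - snd p) ^ d\<close> at \<open>y = snd p + 1\<close> is \<open>1\<close>. Evaluation at this height extracts the factor without
  mentioning coefficients.
\<close>

definition kink ::
    "(real \<times> real) set set \<Rightarrow> ((real \<times> real) set \<Rightarrow> real \<Rightarrow> real \<Rightarrow> real) \<Rightarrow> bool \<Rightarrow> real \<times> real \<Rightarrow> real \<Rightarrow> real"
  where "kink M F \<sigma> p x =
    F (quadrant_cell M \<sigma> True p) x (snd p + 1) - F (quadrant_cell M \<sigma> False p) x (snd p + 1)"

text \<open>
  The smoothing cofactor of a vertex. It is the alternating sum of the four polynomials at the point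
  \<open>p + (1, 1)\<close>, hence symmetric under exchanging the coordinates.
\<close>

definition cofactor ::
    "(real \<times> real) set set \<Rightarrow> ((real \<times> real) set \<Rightarrow> real \<Rightarrow> real \<Rightarrow> real) \<Rightarrow> real \<times> real \<Rightarrow> real"
  where "cofactor M F p = kink M F True p (fst p + 1) - kink M F False p (fst p + 1)"

context box_mesh
begin

lemma quadrant_cell_eq: "quadrant M \<sigma> \<tau> p K \<Longrightarrow> quadrant_cell M \<sigma> \<tau> p = K"
  unfolding quadrant_cell_def by (rule the_equality) (blast dest: quadrant_unique)+

lemma quadrant_cell: "p \<in> interior (\<Union>M) \<Longrightarrow> quadrant M \<sigma> \<tau> p (quadrant_cell M \<sigma> \<tau> p)"
  using quadrant_exists quadrant_cell_eq by metis

lemma kink_eq: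
  assumes "quadrant M \<sigma> True p K" "quadrant M \<sigma> False p K'"
  shows "kink M F \<sigma> p x = F K x (snd p + 1) - F K' x (snd p + 1)"
  unfolding kink_def using assms by (simp add: quadrant_cell_eq)

lemma interior_edge_if_kink:
  assumes "(x, y) \<in> interior (\<Union>M)" "kink M F \<sigma> (x, y) z \<noteq> 0"
  obtains u v where "u < v" "germ_in \<sigma> x u v" "closed_segment (u, y) (v, y) \<in> interior_edges M"
proof -
  have "quadrant_cell M \<sigma> True (x, y) \<noteq> quadrant_cell M \<sigma> False (x, y)"
    using assms(2) by (auto simp: kink_def)
  from interior_edge_if_quadrants_differ[OF assms(1) quadrant_cell[OF assms(1)] quadrant_cell[OF assms(1)] this]
  show thesis
    using that unfolding fst_conv snd_conv by blast
qed

text \<open>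
  A cell that has \<open>p\<close> as a point but not as a corner occupies two adjacent quadrants at \<open>p\<close>, and if it
  occupies two opposite ones, it occupies all four.
\<close>

lemma quadrants_agree_off_vertices:
  assumes "p \<in> interior (\<Union>M)" "p \<notin> vertices M"
  shows "(\<forall>\<tau>. quadrant_cell M True \<tau> p = quadrant_cell M False \<tau> p) \<or>
    (\<forall>\<sigma>. quadrant_cell M \<sigma> True p = quadrant_cell M \<sigma> False p)"
proof -
  obtain x y where p: "p = (x, y)" by (cases p)
  have "quadrant_cell M (\<not> \<sigma>) \<tau> p = quadrant_cell M \<sigma> \<tau> p \<or>
      quadrant_cell M \<sigma> (\<not> \<tau>) p = quadrant_cell M \<sigma> \<tau> p" for \<sigma> \<tau>
  proof -
    obtain a b c e where K: "quadrant_cell M \<sigma> \<tau> p = cbox (a, c) (b, e)"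
      "cbox (a, c) (b, e) \<in> M" "germ_in \<sigma> x a b" "germ_in \<tau> y c e"
      using quadrant_cell[OF assms(1), of \<sigma> \<tau>] unfolding quadrant_def p by auto
    have "x \<notin> {a, b} \<or> y \<notin> {c, e}"
      using corner_vertex[OF K(2), of x y] assms(2) p by blast
    then have "germ_in (\<not> \<sigma>) x a b \<or> germ_in (\<not> \<tau>) y c e"
      using K(3,4) by (auto simp: germ_in_def split: if_splits)
    moreover have "quadrant_cell M (\<not> \<sigma>) \<tau> p = cbox (a, c) (b, e)" if "germ_in (\<not> \<sigma>) x a b"
      using that K(2,4) p by (intro quadrant_cell_eq quadrantI) simp_all
    moreover have "quadrant_cell M \<sigma> (\<not> \<tau>) p = cbox (a, c) (b, e)" if "germ_in (\<not> \<tau>) y c e"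
      using that K(2,3) p by (intro quadrant_cell_eq quadrantI) simp_all
    ultimately show ?thesis
      unfolding K(1) by blast
  qed
  note adj = this[of True True] this[of False False] this[of True False] this[of False True]
  have opp: "quadrant_cell M \<sigma> (\<not> \<tau>) p = quadrant_cell M \<sigma> \<tau> p"
    if "quadrant_cell M (\<not> \<sigma>) (\<not> \<tau>) p = quadrant_cell M \<sigma> \<tau> p" for \<sigma> \<tau>
  proof -
    let ?K = "quadrant_cell M \<sigma> \<tau> p"
    have "quadrant M \<sigma> \<tau> p ?K" "quadrant M (\<not> \<sigma>) (\<not> \<tau>) p ?K"
      using quadrant_cell[OF assms(1)] that by metis+
    then obtain a b c e a' b' c' e' where K: "?K = cbox (a, c) (b, e)" "?K = cbox (a', c') (b', e')"
      "?K \<in> M" "germ_in \<sigma> x a b" "germ_in \<tau> y c e" "germ_in (\<not> \<sigma>) x a' b'" "germ_in (\<not> \<tau>) y c' e'"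
      unfolding quadrant_def p by auto
    have "c = c' \<and> e = e'"
      using cbox_pair_inject[of a c b e a' c' b' e'] K germ_in_mem by metis
    then have "quadrant M \<sigma> (\<not> \<tau>) p ?K"
      using K unfolding quadrant_def p by auto
    then show ?thesis
      by (rule quadrant_cell_eq)
  qed
  define TT TF FT FF where "TT = quadrant_cell M True True p" "TF = quadrant_cell M True False p"
    "FT = quadrant_cell M False True p" "FF = quadrant_cell M False False p"
  note defs = this
  have "FT = TT \<or> TF = TT" "TF = FF \<or> FT = FF" "FF = TT \<Longrightarrow> TF = TT" "TT = FF \<Longrightarrow> FT = FF"
    using adj(1,2) opp[of True True] opp[of False False] unfolding defs by simp_all
  then have "TT = FT \<and> TF = FF \<or> TT = TF \<and> FT = FF"
    by metis
  then show ?thesis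
    unfolding defs all_bool_eq by blast
qed

end

text \<open>
  A polynomial for each cell, such that polynomials of neighbouring cells differ by a multiple of the
  \<open>d\<close>-th power that vanishes on the common line. This is the form in which smoothness is used; unlike the
  smoothness of a function, it is visibly preserved under transposition.
\<close>

locale spline_jumps = box_mesh M for M +
  fixes d :: nat and F :: "(real \<times> real) set \<Rightarrow> real \<Rightarrow> real \<Rightarrow> real"
  assumes jump_y: "\<And>\<sigma> p K K' x y. quadrant M \<sigma> True p K \<Longrightarrow> quadrant M \<sigma> False p K' \<Longrightarrow>
      F K x y - F K' x y = (F K x (snd p + 1) - F K' x (snd p + 1)) * (y - snd p) ^ d"
    and jump_x: "\<And>\<tau> p K K' x y. quadrant M True \<tau> p K \<Longrightarrow> quadrant M False \<tau> p K' \<Longrightarrow>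
      F K x y - F K' x y = (F K (fst p + 1) y - F K' (fst p + 1) y) * (x - fst p) ^ d"
begin

text \<open>
  The differences between right and left, for the upper and for the lower cells, are both multiples of
  \<open>(x - fst p) ^ d\<close>.
\<close>

lemma kink_jump:
  assumes "p \<in> interior (\<Union>M)"
  shows "kink M F True p x - kink M F False p x = cofactor M F p * (x - fst p) ^ d"
  using jump_x[of True p "quadrant_cell M True True p" "quadrant_cell M False True p" x "snd p + 1"]
    jump_x[of False p "quadrant_cell M True False p" "quadrant_cell M False False p" x "snd p + 1"]
    quadrant_cell[OF assms]
  unfolding cofactor_def kink_def by (simp add: algebra_simps)

lemma cofactor_off_vertices:
  assumes "p \<in> interior (\<Union>M)" "p \<notin> vertices M"
  shows "cofactor M F p = 0"
  using quadrants_agree_off_vertices[OF assms] unfolding cofactor_def kink_def by auto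

text \<open>
  The cells at \<open>(a, y)\<close> on one side also occupy the quadrants at the nearby points on that side.
\<close>

lemma kink_near:
  assumes "(a, y) \<in> interior (\<Union>M)"
  shows "eventually (\<lambda>b. \<forall>\<sigma>. kink M F \<sigma> (b, y) z = kink M F True (a, y) z) (at_right a)"
    "eventually (\<lambda>b. \<forall>\<sigma>. kink M F \<sigma> (b, y) z = kink M F False (a, y) z) (at_left a)"
proof -
  have *: "\<exists>a0 b0. germ_in \<sigma>' a a0 b0 \<and> (\<forall>b. a0 < b \<longrightarrow> b < b0 \<longrightarrow>
      (\<forall>\<sigma>. quadrant M \<sigma> \<tau> (b, y) (quadrant_cell M \<sigma>' \<tau> (a, y))))" for \<sigma>' \<tau>
  proof -
    obtain a0 b0 c e where K: "quadrant_cell M \<sigma>' \<tau> (a, y) = cbox (a0, c) (b0, e)"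
      "cbox (a0, c) (b0, e) \<in> M" "germ_in \<sigma>' a a0 b0" "germ_in \<tau> y c e"
      using quadrant_cell[OF assms, of \<sigma>' \<tau>] unfolding quadrant_def by auto
    have "quadrant M \<sigma> \<tau> (b, y) (quadrant_cell M \<sigma>' \<tau> (a, y))" if "a0 < b" "b < b0" for b \<sigma>
      using K(4) that unfolding K(1) by (intro quadrantI[OF K(2)]) (auto simp: germ_in_def)
    with K(3) show ?thesis by blast
  qed
  have kinks: "\<exists>a0 b0. germ_in \<sigma>' a a0 b0 \<and> (\<forall>b. a0 < b \<longrightarrow> b < b0 \<longrightarrow>
      (\<forall>\<sigma>. kink M F \<sigma> (b, y) z = kink M F \<sigma>' (a, y) z))" for \<sigma>'
  proof -
    obtain a0 b0 where 0: "germ_in \<sigma>' a a0 b0" "\<And>b \<sigma>. a0 < b \<Longrightarrow> b < b0 \<Longrightarrow>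
        quadrant M \<sigma> True (b, y) (quadrant_cell M \<sigma>' True (a, y))"
      using *[of \<sigma>' True] by blast
    obtain a1 b1 where 1: "germ_in \<sigma>' a a1 b1" "\<And>b \<sigma>. a1 < b \<Longrightarrow> b < b1 \<Longrightarrow>
        quadrant M \<sigma> False (b, y) (quadrant_cell M \<sigma>' False (a, y))"
      using *[of \<sigma>' False] by blast
    have "kink M F \<sigma> (b, y) z = kink M F \<sigma>' (a, y) z" if "max a0 a1 < b" "b < min b0 b1" for b \<sigma>
      using kink_eq[OF 0(2)[of b \<sigma>] 1(2)[of b \<sigma>], of F z] that by (simp add: kink_def)
    moreover have "germ_in \<sigma>' a (max a0 a1) (min b0 b1)"
      using 0(1) 1(1) by (auto simp: germ_in_def split: if_splits)
    ultimately show ?thesis by blast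
  qed
  obtain a0 b0 where r: "germ_in True a a0 b0"
    "\<And>b \<sigma>. a0 < b \<Longrightarrow> b < b0 \<Longrightarrow> kink M F \<sigma> (b, y) z = kink M F True (a, y) z"
    using kinks[of True] by blast
  then have "eventually (\<lambda>b. b \<in> {a<..<b0}) (at_right a)"
    by (intro eventually_at_right_real) (simp add: germ_in_def)
  then show "eventually (\<lambda>b. \<forall>\<sigma>. kink M F \<sigma> (b, y) z = kink M F True (a, y) z) (at_right a)"
    by eventually_elim (use r in \<open>auto simp: germ_in_def\<close>)
  obtain a0 b0 where l: "germ_in False a a0 b0"
    "\<And>b \<sigma>. a0 < b \<Longrightarrow> b < b0 \<Longrightarrow> kink M F \<sigma> (b, y) z = kink M F False (a, y) z"
    using kinks[of False] by blast
  then have "eventually (\<lambda>b. b \<in> {a0<..<a}) (at_left a)"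
    by (intro eventually_at_left_real) (simp add: germ_in_def)
  then show "eventually (\<lambda>b. \<forall>\<sigma>. kink M F \<sigma> (b, y) z = kink M F False (a, y) z) (at_left a)"
    by eventually_elim (use l in \<open>auto simp: germ_in_def\<close>)
qed

text \<open>
  The difference of the kink to the right of \<open>b\<close> and the sum of all terms up to \<open>b\<close> is a locally constant
  function of \<open>b\<close>: between vertices neither part changes, and at a vertex both jump by the same
  amount.
\<close>

lemma kink_telescope:
  assumes "x1 \<le> x2" "\<And>x. x1 \<le> x \<Longrightarrow> x \<le> x2 \<Longrightarrow> (x, y) \<in> interior (\<Union>M)"
  shows "kink M F True (x2, y) z - kink M F False (x1, y) z =
    (\<Sum>v\<in>{v \<in> vertices M. snd v = y \<and> x1 \<le> fst v \<and> fst v \<le> x2}. cofactor M F v * (z - fst v) ^ d)"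
proof -
  define V where "V b = {v \<in> vertices M. snd v = y \<and> x1 \<le> fst v \<and> fst v \<le> b}" for b
  define c where "c v = cofactor M F v * (z - fst v) ^ d" for v
  define G where "G b = kink M F True (b, y) z - sum c (V b)" for b
  have finV: "finite (V b)" for b
    using finite_vertices by (simp add: V_def)
  have c_off: "c (x, y) = 0" if "x1 \<le> x" "x \<le> x2" "(x, y) \<notin> vertices M" for x
    using cofactor_off_vertices[OF assms(2)[OF that(1,2)] that(3)] by (simp add: c_def)
  have split_last: "sum c (V a) = sum c (V a - {(a, y)}) + c (a, y)" if "x1 \<le> a" "a \<le> x2" for a
  proof (cases "(a, y) \<in> vertices M")
    case True
    then have "(a, y) \<in> V a" using that by (simp add: V_def)
    then show ?thesis using finV by (simp add: sum.remove[of "V a" "(a, y)"])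
  next
    case False
    then have "(a, y) \<notin> V a" by (simp add: V_def)
    then show ?thesis using c_off[OF that False] by simp
  qed
  have jump: "kink M F True (a, y) z - c (a, y) = kink M F False (a, y) z" if "x1 \<le> a" "a \<le> x2" for a
    using kink_jump[OF assms(2)[OF that], of z] by (simp add: c_def)
  have "G x1 = G x2"
  proof (rule connected_local_const[of "{x1..x2}" x1 x2 G])
    show "\<forall>a\<in>{x1..x2}. eventually (\<lambda>b. G a = G b) (at a within {x1..x2})"
    proof
      fix a assume "a \<in> {x1..x2}"
      then have a: "x1 \<le> a" "a \<le> x2" by auto
      have "eventually (\<lambda>b. \<forall>v\<in>vertices M. \<not> (a < fst v \<and> fst v \<le> b)) (at_right a)"
      proof (intro eventually_ball_finite finite_vertices ballI)
        fix v
        show "eventually (\<lambda>b. \<not> (a < fst v \<and> fst v \<le> b)) (at_right a)"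
          using eventually_at_right_real[of a "fst v"] by (cases "a < fst v") (auto elim: eventually_mono)
      qed
      then have right: "eventually (\<lambda>b. b \<in> {x1..x2} \<longrightarrow> G a = G b) (at_right a)"
        using kink_near(1)[OF assms(2)[OF a], of z] eventually_at_right_less[of a]
      proof eventually_elim
        case (elim b)
        then have "V b = V a"
          using elim unfolding V_def by fastforce
        with elim show ?case by (simp add: G_def)
      qed
      have "eventually (\<lambda>b. \<forall>v\<in>vertices M. \<not> (b < fst v \<and> fst v < a)) (at_left a)"
      proof (intro eventually_ball_finite finite_vertices ballI)
        fix v
        show "eventually (\<lambda>b. \<not> (b < fst v \<and> fst v < a)) (at_left a)"
          using eventually_at_left_real[of "fst v" a] by (cases "fst v < a") (auto elim: eventually_mono)
      qed
      moreover have "eventually (\<lambda>b. b < a) (at_left a)"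
        by (simp add: eventually_at_filter)
      ultimately have left: "eventually (\<lambda>b. b \<in> {x1..x2} \<longrightarrow> G a = G b) (at_left a)"
        using kink_near(2)[OF assms(2)[OF a], of z]
      proof eventually_elim
        case (elim b)
        show ?case
        proof
          have "V b = V a - {(a, y)}"
            using elim(1,2) unfolding V_def by fastforce
          then have "sum c (V a) = sum c (V b) + c (a, y)"
            using split_last[OF a] by simp
          then show "G a = G b"
            using elim(3) jump[OF a] by (simp add: G_def)
        qed
      qed
      have "eventually (\<lambda>b. b \<in> {x1..x2} \<longrightarrow> G a = G b) (at a)"
        using left right by (simp add: eventually_at_split)
      then show "eventually (\<lambda>b. G a = G b) (at a within {x1..x2})"
        by (simp add: eventually_at_filter)
    qed
  qed (use assms(1) in auto)
  moreover have "V x1 - {(x1, y)} = {}"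
    by (auto simp: V_def)
  then have "sum c (V x1 - {(x1, y)}) = 0"
    by (simp only: sum.empty)
  then have "sum c (V x1) = c (x1, y)"
    using split_last[of x1] assms(1) by simp
  ultimately show ?thesis
    using jump[of x1] assms(1) unfolding G_def V_def c_def by simp
qed

text \<open>
  Otherwise there would be an interior edge beyond the end, and the run could be prolonged.
\<close>

lemma kink_vanishes_at_run_end:
  assumes "maximal_run M (closed_segment (\<alpha>, y) (\<beta>, y))" "\<alpha> < \<beta>"
    and "x = (if \<sigma> then \<beta> else \<alpha>)" "(x, y) \<in> interior (\<Union>M)"
  shows "kink M F \<sigma> (x, y) z = 0"
proof (rule ccontr)
  let ?l = "closed_segment (\<alpha>, y) (\<beta>, y)"
  assume "kink M F \<sigma> (x, y) z \<noteq> 0"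
  then obtain u v where uv: "u < v" "germ_in \<sigma> x u v" "closed_segment (u, y) (v, y) \<in> interior_edges M"
    using interior_edge_if_kink[OF assms(4)] by blast
  have run: "?l \<in> interior_runs M" and max: "\<And>l'. l' \<in> interior_runs M \<Longrightarrow> \<not> ?l \<subset> l'"
    using assms(1) by (auto simp: maximal_run_def)
  have eq: "?l \<union> closed_segment (u, y) (v, y) = closed_segment (min \<alpha> u, y) (max \<beta> v, y)"
    using germ_in_mem[OF uv(2)] assms(2,3) uv(1) by (intro hseg_Un) (auto split: if_splits)
  have "min \<alpha> u < max \<beta> v" using assms(2) by auto
  then have "horizontal (?l \<union> closed_segment (u, y) (v, y))"
    unfolding eq by (rule horizontal_hseg)
  then have "?l \<union> closed_segment (u, y) (v, y) \<in> interior_runs M"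
    using run edge_in_runs[OF uv(3)] by (intro interior_run_union) auto
  then have "closed_segment (u, y) (v, y) \<subseteq> ?l"
    using max by blast
  then have "(u, y) \<in> ?l" "(v, y) \<in> ?l"
    by auto
  then have "\<alpha> \<le> u" "v \<le> \<beta>"
    using assms(2) by (simp_all add: mem_closed_hseg)
  then show False
    using uv(2) assms(3) by (auto simp: germ_in_def split: if_splits)
qed

lemma run_relation:
  assumes "maximal_run M (closed_segment (\<alpha>, y) (\<beta>, y))" "\<alpha> < \<beta>"
    and ends: "(\<alpha>, y) \<in> interior (\<Union>M)" "(\<beta>, y) \<in> interior (\<Union>M)"
  shows "(\<Sum>v\<in>vertices M \<inter> closed_segment (\<alpha>, y) (\<beta>, y). cofactor M F v * (z - fst v) ^ d) = 0"
proof -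
  have "closed_segment (\<alpha>, y) (\<beta>, y) \<subseteq> interior (\<Union>M)"
    by (rule horizontal_run_subset_interior[OF assms(1) horizontal_hseg[OF assms(2)] refl]) (use ends in simp)
  then have int: "(x, y) \<in> interior (\<Union>M)" if "\<alpha> \<le> x" "x \<le> \<beta>" for x
    using mem_closed_hseg[OF assms(2), of "(x, y)" y] that by auto
  have "vertices M \<inter> closed_segment (\<alpha>, y) (\<beta>, y) =
      {v \<in> vertices M. snd v = y \<and> \<alpha> \<le> fst v \<and> fst v \<le> \<beta>}"
    using assms(2) by (auto simp: mem_closed_hseg)
  then show ?thesis
    using kink_telescope[of \<alpha> \<beta> y z] int assms(2)
      kink_vanishes_at_run_end[OF assms(1,2) _ ends(1), of False z]
      kink_vanishes_at_run_end[OF assms(1,2) _ ends(2), of True z]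
    by simp
qed

text \<open>
  When all cofactors are zero, the kink does not change along a run. It is zero at an end inside the domain,
  and a maximal run without such an end is a cross-cut, on which a single point is enough.
\<close>

lemma kinks_vanish:
  assumes cof: "\<And>v. v \<in> interior_vertices M \<Longrightarrow> cofactor M F v = 0"
    and cuts: "\<And>l u v. maximal_run M l \<Longrightarrow> horizontal l \<Longrightarrow> l = closed_segment u v \<Longrightarrow>
      {u, v} \<subseteq> boundary_vertices M \<Longrightarrow> \<exists>q\<in>l \<inter> interior (\<Union>M). \<forall>x. kink M F True q x = 0"
    and p: "p \<in> interior (\<Union>M)"
  shows "kink M F \<sigma> p z = 0"
proof (rule ccontr)
  assume "kink M F \<sigma> p z \<noteq> 0"
  obtain x0 y where p0: "p = (x0, y)" by (cases p)
  have cof0: "cofactor M F q = 0" if "q \<in> interior (\<Union>M)" for q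
    using cof cofactor_off_vertices that unfolding interior_vertices_def by blast
  have sides: "kink M F \<sigma> q z = kink M F \<tau> q z" if "q \<in> interior (\<Union>M)" for \<sigma> \<tau> q
    using kink_jump[OF that, of z] cof0[OF that] by (cases \<sigma>; cases \<tau>) auto
  obtain u v where uv: "u < v" "germ_in \<sigma> x0 u v" "closed_segment (u, y) (v, y) \<in> interior_edges M"
    using interior_edge_if_kink[of x0 y F \<sigma> z] p \<open>kink M F \<sigma> p z \<noteq> 0\<close> p0 by metis
  obtain l where l: "maximal_run M l" "closed_segment (u, y) (v, y) \<subseteq> l"
    using maximal_run_exists[OF edge_in_runs[OF uv(3)]] by blast
  have "horizontal l"
  proof (rule ccontr)
    assume "\<not> horizontal l"
    then have "vertical l"
      using l(1) unfolding maximal_run_def interior_runs_def by blast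
    then obtain x a b where "a < b" "l = closed_segment (x, a) (x, b)"
      unfolding vertical_def by blast
    then have "closed_segment (u, y) (v, y) \<subseteq> {q. fst q = x}"
      using l(2) by (force simp: in_segment algebra_simps)
    then have "(u, y) \<in> {q. fst q = x}" "(v, y) \<in> {q. fst q = x}"
      using ends_in_segment by blast+
    then show False using uv(1) by simp
  qed
  then obtain \<alpha> \<beta> y' where ab: "\<alpha> < \<beta>" "l = closed_segment (\<alpha>, y') (\<beta>, y')"
    unfolding horizontal_def by blast
  have "p \<in> l"
    using l(2) germ_in_mem[OF uv(2)] uv(1) p0 by (force simp: mem_closed_hseg)
  then have "y' = y" "\<alpha> \<le> x0" "x0 \<le> \<beta>"
    using ab p0 by (auto simp: mem_closed_hseg)
  note ab = ab[unfolded \<open>y' = y\<close>]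
  have run: "closed_segment (\<alpha>, y) (\<beta>, y) \<in> interior_runs M"
    using l(1) ab(2) by (simp add: maximal_run_def)
  have along: "kink M F \<sigma> (x2, y) z = kink M F \<sigma> (x1, y) z"
    if "\<alpha> \<le> x1" "x1 \<le> x2" "x2 \<le> \<beta>" "(x1, y) \<in> interior (\<Union>M)" "(x2, y) \<in> interior (\<Union>M)" for x1 x2
  proof -
    have int: "(x, y) \<in> interior (\<Union>M)" if "x1 \<le> x" "x \<le> x2" for x
      using interior_run_points[OF run, of x] that \<open>\<alpha> \<le> x1\<close> \<open>x2 \<le> \<beta>\<close> \<open>(x1, y) \<in> _\<close> \<open>(x2, y) \<in> _\<close>
      by (cases "x = x1 \<or> x = x2") auto
    have "cofactor M F w * (z - fst w) ^ d = 0"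
      if "w \<in> {w \<in> vertices M. snd w = y \<and> x1 \<le> fst w \<and> fst w \<le> x2}" for w
    proof -
      have "w = (fst w, y)"
        using that by (auto simp: prod_eq_iff)
      then have "w \<in> interior (\<Union>M)"
        using int[of "fst w"] that by auto
      then show ?thesis by (simp add: cof0)
    qed
    then have "(\<Sum>w\<in>{w \<in> vertices M. snd w = y \<and> x1 \<le> fst w \<and> fst w \<le> x2}.
        cofactor M F w * (z - fst w) ^ d) = 0"
      by (rule sum.neutral[OF ballI])
    then have "kink M F True (x2, y) z = kink M F False (x1, y) z"
      using kink_telescope[OF \<open>x1 \<le> x2\<close> int, of z] by simp
    then show ?thesis
      using sides that(4,5) by metis
  qed
  have "\<exists>x. \<alpha> \<le> x \<and> x \<le> \<beta> \<and> (x, y) \<in> interior (\<Union>M) \<and> kink M F \<sigma> (x, y) z = 0"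
  proof (cases "(\<alpha>, y) \<in> interior (\<Union>M) \<or> (\<beta>, y) \<in> interior (\<Union>M)")
    case True
    then show ?thesis
      using kink_vanishes_at_run_end[of \<alpha> y \<beta> \<alpha> False z] kink_vanishes_at_run_end[of \<alpha> y \<beta> \<beta> True z]
        l(1) ab sides less_imp_le by (metis order_refl)
  next
    case False
    have "(\<alpha>, y) \<in> \<Union>M" "(\<beta>, y) \<in> \<Union>M"
      using interior_run_ends(3)[OF run ab(1)] by auto
    then have "{(\<alpha>, y), (\<beta>, y)} \<subseteq> boundary_vertices M"
      using False interior_run_ends(1,2)[OF run ab(1)] closed_domain
      unfolding boundary_vertices_def frontier_def by auto
    then obtain q where "q \<in> l" "q \<in> interior (\<Union>M)" "kink M F True q z = 0"
      using cuts[OF l(1) \<open>horizontal l\<close> ab(2)] by blast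
    moreover from this have "q = (fst q, y)" "\<alpha> \<le> fst q" "fst q \<le> \<beta>"
      using ab by (auto simp: mem_closed_hseg prod_eq_iff)
    ultimately show ?thesis
      using sides by metis
  qed
  then obtain x where x: "\<alpha> \<le> x" "x \<le> \<beta>" "(x, y) \<in> interior (\<Union>M)" "kink M F \<sigma> (x, y) z = 0"
    by blast
  have "kink M F \<sigma> p z = 0"
  proof (cases "x \<le> x0")
    case True
    then show ?thesis
      using along[of x x0] x \<open>x0 \<le> \<beta>\<close> p p0 by simp
  next
    case False
    then show ?thesis
      using along[of x0 x] x \<open>\<alpha> \<le> x0\<close> p p0 by simp
  qed
  with \<open>kink M F \<sigma> p z \<noteq> 0\<close> show False by simp
qed

end

section \<open>Transposition\<close>

text \<open>
  Transposition exchanges horizontal and vertical. It is an involution, so each of the facts below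
  needs a proof in one direction only.
\<close>

abbreviation flip :: "(real \<times> real) set \<Rightarrow> (real \<times> real) set" where
  "flip X \<equiv> prod.swap ` X"

lemma linear_swap: "linear (prod.swap :: real \<times> real \<Rightarrow> real \<times> real)"
  by (rule linearI) auto

lemma inj_swap: "inj (prod.swap :: real \<times> real \<Rightarrow> real \<times> real)"
  by (rule inj_swap)

lemma flip_flip [simp]: "flip (flip X) = X"
  by (simp add: image_image)

lemma flip_image_flip [simp]: "flip ` (flip ` X) = X"
  by (simp add: image_image)

lemma swap_mem_flip [simp]: "prod.swap p \<in> flip X \<longleftrightarrow> p \<in> X"
  by (metis imageE imageI swap_swap)

lemma mem_flip: "p \<in> flip X \<longleftrightarrow> prod.swap p \<in> X"
  using swap_mem_flip[of "prod.swap p" X] by simp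

lemma Union_flip: "\<Union>(flip ` X) = flip (\<Union>X)"
  by auto

lemma interior_flip: "interior (flip X) = flip (interior X)"
  by (rule interior_injective_linear_image[OF linear_swap inj_swap])

lemma frontier_flip: "frontier (flip X) = flip (frontier X)"
  unfolding frontier_def interior_flip closure_injective_linear_image[OF linear_swap inj_swap, symmetric]
  by (rule image_set_diff[OF inj_swap, symmetric])

lemma closed_segment_flip: "closed_segment (prod.swap u) (prod.swap v) = flip (closed_segment u v)"
  by (rule closed_segment_linear_image[OF linear_swap])

lemma open_segment_flip: "open_segment (prod.swap u) (prod.swap v) = flip (open_segment u v)"
  by (rule open_segment_linear_image[OF linear_swap inj_swap])

lemma vertical_flip:
  assumes "horizontal l"
  shows "vertical (flip l)"
proof -
  obtain a b y where "a < b" "l = closed_segment (a, y) (b, y)"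
    using assms unfolding horizontal_def by blast
  then show ?thesis
    using closed_segment_flip[of "(a, y)" "(b, y)"] unfolding vertical_def prod.swap_def fst_conv snd_conv by metis
qed

lemma horizontal_flip:
  assumes "vertical l"
  shows "horizontal (flip l)"
proof -
  obtain a b x where "a < b" "l = closed_segment (x, a) (x, b)"
    using assms unfolding vertical_def by blast
  then show ?thesis
    using closed_segment_flip[of "(x, a)" "(x, b)"] unfolding horizontal_def prod.swap_def fst_conv snd_conv by metis
qed

lemma flip_cbox: "flip (cbox u v) = cbox (prod.swap u) (prod.swap v)"
  by (cases u; cases v) simp

lemma swap_vertices:
  assumes "p \<in> vertices M"
  shows "prod.swap p \<in> vertices (flip ` M)"
proof -
  obtain a b where "cbox a b \<in> M" "fst p \<in> {fst a, fst b}" "snd p \<in> {snd a, snd b}"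
    using assms unfolding vertices_def by auto
  moreover from this have "cbox (prod.swap a) (prod.swap b) \<in> flip ` M"
    by (metis imageI flip_cbox)
  ultimately show ?thesis
    unfolding vertices_def mem_Collect_eq case_prod_unfold
    by (intro exI[of _ "prod.swap a"] exI[of _ "prod.swap b"]) simp
qed

lemma vertices_flip: "vertices (flip ` M) = flip (vertices M)"
proof
  show "vertices (flip ` M) \<subseteq> flip (vertices M)"
    using swap_vertices[of _ "flip ` M"] by (auto simp: mem_flip)
  show "flip (vertices M) \<subseteq> vertices (flip ` M)"
    using swap_vertices by blast
qed

lemma boundary_vertices_flip: "boundary_vertices (flip ` M) = flip (boundary_vertices M)"
  unfolding boundary_vertices_def Union_flip frontier_flip vertices_flip
  by (rule image_Int[OF inj_swap, symmetric])

lemma interior_vertices_flip: "interior_vertices (flip ` M) = flip (interior_vertices M)"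
  unfolding interior_vertices_def Union_flip interior_flip vertices_flip
  by (rule image_Int[OF inj_swap, symmetric])

lemma edges_flip:
  assumes "e \<in> edges M"
  shows "flip e \<in> edges (flip ` M)"
proof -
  obtain u v where uv: "e = closed_segment u v" "u \<in> vertices M" "v \<in> vertices M"
    "horizontal (closed_segment u v) \<or> vertical (closed_segment u v)"
    "closed_segment u v \<subseteq> (\<Union>K\<in>M. frontier K)" "open_segment u v \<inter> vertices M = {}"
    using assms unfolding edges_def by blast
  let ?u = "prod.swap u" and ?v = "prod.swap v"
  have "horizontal (closed_segment ?u ?v) \<or> vertical (closed_segment ?u ?v)"
    using uv(4) vertical_flip horizontal_flip unfolding closed_segment_flip by blast
  moreover have "(\<Union>K\<in>flip ` M. frontier K) = flip (\<Union>K\<in>M. frontier K)"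
    by (simp add: frontier_flip image_UN)
  then have "closed_segment ?u ?v \<subseteq> (\<Union>K\<in>flip ` M. frontier K)"
    using uv(5) unfolding closed_segment_flip by (simp only: image_mono)
  moreover have "open_segment ?u ?v \<inter> vertices (flip ` M) = {}"
    unfolding open_segment_flip vertices_flip image_Int[OF inj_swap, symmetric] uv(6) by simp
  moreover have "?u \<in> vertices (flip ` M)" "?v \<in> vertices (flip ` M)"
    using uv(2,3) by (auto simp: vertices_flip)
  moreover have "flip e = closed_segment ?u ?v"
    unfolding uv(1) closed_segment_flip ..
  ultimately show ?thesis
    unfolding edges_def by blast
qed

lemma interior_edges_flip:
  assumes "e \<in> interior_edges M"
  shows "flip e \<in> interior_edges (flip ` M)"
  using assms edges_flip[of e M] unfolding interior_edges_def Union_flip frontier_flip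
  by (simp add: inj_image_subset_iff[OF inj_swap])

lemma interior_runs_flip:
  assumes "l \<in> interior_runs M"
  shows "flip l \<in> interior_runs (flip ` M)"
proof -
  obtain E where E: "E \<subseteq> interior_edges M" "l = \<Union>E" and "horizontal l \<or> vertical l"
    using assms unfolding interior_runs_def by blast
  moreover have "flip ` E \<subseteq> interior_edges (flip ` M)"
    using E(1) interior_edges_flip by blast
  ultimately show ?thesis
    using vertical_flip[of l] horizontal_flip[of l] Union_flip[of E]
    unfolding interior_runs_def by blast
qed

lemma maximal_run_flip:
  assumes "maximal_run M l"
  shows "maximal_run (flip ` M) (flip l)"
  unfolding maximal_run_def
proof (intro conjI ballI)
  show "flip l \<in> interior_runs (flip ` M)"
    using assms interior_runs_flip by (simp add: maximal_run_def)
  fix k assume "k \<in> interior_runs (flip ` M)"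
  then have "flip k \<in> interior_runs M"
    using interior_runs_flip[of k "flip ` M"] by simp
  then have "\<not> l \<subset> flip k"
    using assms by (simp add: maximal_run_def)
  moreover have "l \<subset> flip k" if "flip l \<subset> k"
    using that by (metis image_mono psubset_eq flip_flip)
  ultimately show "\<not> flip l \<subset> k" by blast
qed

lemma quadrant_flip:
  assumes "quadrant M \<sigma> \<tau> p K"
  shows "quadrant (flip ` M) \<tau> \<sigma> (prod.swap p) (flip K)"
proof -
  obtain a b c e where "K \<in> M" "K = cbox (a, c) (b, e)" "germ_in \<sigma> (fst p) a b" "germ_in \<tau> (snd p) c e"
    using assms unfolding quadrant_def by blast
  then show ?thesis
    unfolding quadrant_def
    by (intro conjI imageI exI[of _ a] exI[of _ b] exI[of _ c] exI[of _ e]) (auto simp: flip_cbox)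
qed

lemma box_mesh_flip:
  assumes "box_mesh M"
  shows "box_mesh (flip ` M)"
proof
  interpret box_mesh M by fact
  show "finite (flip ` M)" using fin by simp
  show "\<exists>a b c e. a < b \<and> c < e \<and> K = cbox (a, c) (b, e)" if K: "K \<in> flip ` M" for K
  proof -
    obtain K' where "K' \<in> M" "K = flip K'"
      using K by blast
    moreover from this obtain a b c e where "a < b" "c < e" "K' = cbox (a, c) (b, e)"
      using boxes by blast
    ultimately show ?thesis
      by (intro exI[of _ c] exI[of _ e] exI[of _ a] exI[of _ b]) (simp add: flip_cbox)
  qed
  show "K = K'" if K: "K \<in> flip ` M" "K' \<in> flip ` M" "interior K \<inter> interior K' \<noteq> {}" for K K'
  proof -
    obtain L L' where L: "L \<in> M" "L' \<in> M" "K = flip L" "K' = flip L'"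
      using K(1,2) by blast
    have "interior L \<inter> interior L' \<noteq> {}"
      using K(3) unfolding L(3,4) interior_flip image_Int[OF inj_swap, symmetric] by blast
    then show ?thesis
      using nonoverlapping[OF L(1,2)] L(3,4) by simp
  qed
qed

lemma quadrant_flip_iff:
  "quadrant (flip ` M) \<sigma> \<tau> p K \<longleftrightarrow> quadrant M \<tau> \<sigma> (prod.swap p) (flip K)"
  using quadrant_flip[of "flip ` M" \<sigma> \<tau> p K] quadrant_flip[of M \<tau> \<sigma> "prod.swap p" "flip K"]
  by auto

lemma spline_jumps_flip:
  assumes "spline_jumps M d F"
  shows "spline_jumps (flip ` M) d (\<lambda>K x y. F (flip K) y x)"
proof -
  interpret spline_jumps M d F by fact
  interpret T: box_mesh "flip ` M"
    by (rule box_mesh_flip) (rule box_mesh_axioms)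
  show ?thesis
  proof
    fix \<sigma> p K K' and x y :: real
    assume "quadrant (flip ` M) \<sigma> True p K" "quadrant (flip ` M) \<sigma> False p K'"
    then show "F (flip K) y x - F (flip K') y x =
        (F (flip K) (snd p + 1) x - F (flip K') (snd p + 1) x) * (y - snd p) ^ d"
      using jump_x[of \<sigma> "prod.swap p" "flip K" "flip K'" y x] by (simp add: quadrant_flip_iff)
  next
    fix \<tau> p K K' and x y :: real
    assume "quadrant (flip ` M) True \<tau> p K" "quadrant (flip ` M) False \<tau> p K'"
    then show "F (flip K) y x - F (flip K') y x =
        (F (flip K) y (fst p + 1) - F (flip K') y (fst p + 1)) * (x - fst p) ^ d"
      using jump_y[of \<tau> "prod.swap p" "flip K" "flip K'" y x] by (simp add: quadrant_flip_iff)
  qed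
qed

lemma cofactor_flip:
  assumes "box_mesh M" "p \<in> interior (\<Union>M)"
  shows "cofactor (flip ` M) (\<lambda>K x y. F (flip K) y x) (prod.swap p) = cofactor M F p"
proof -
  interpret box_mesh M by fact
  interpret T: box_mesh "flip ` M"
    by (rule box_mesh_flip) fact
  have "quadrant_cell (flip ` M) \<sigma> \<tau> (prod.swap p) = flip (quadrant_cell M \<tau> \<sigma> p)" for \<sigma> \<tau>
    using quadrant_flip[OF quadrant_cell[OF assms(2)]] by (rule T.quadrant_cell_eq)
  then show ?thesis
    unfolding cofactor_def kink_def by simp
qed

section \<open>Splines as families of polynomials\<close>

text \<open>
  On a vertical segment in the domain the derivatives of \<open>s\<close> are those of the polynomial: derivatives within
  a nondegenerate interval are unique, and restriction to a smaller set preserves them. The functions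
  \<open>g i\<close> belong to \<open>s\<close> alone, so two polynomials on segments that share a point have the same
  derivatives there.
\<close>

lemma directional_derivatives_poly:
  assumes g0: "\<And>p. p \<in> \<Phi> \<Longrightarrow> g 0 p = s p"
    and gS: "\<And>i p. i < k \<Longrightarrow> p \<in> \<Phi> \<Longrightarrow> ((\<lambda>t. g i (p + t *\<^sub>R (0, 1))) has_real_derivative g (Suc i) p)
        (at 0 within {t. p + t *\<^sub>R (0, 1) \<in> \<Phi>})"
    and seg: "c < e" "\<And>y. c \<le> y \<Longrightarrow> y \<le> e \<Longrightarrow> (x, y) \<in> \<Phi>"
    and s: "\<And>y. c \<le> y \<Longrightarrow> y \<le> e \<Longrightarrow> s (x, y) = poly q y"
  shows "i \<le> k \<Longrightarrow> c \<le> y \<Longrightarrow> y \<le> e \<Longrightarrow> g i (x, y) = poly ((pderiv ^^ i) q) y"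
proof (induction i arbitrary: y)
  case 0
  then show ?case
    using g0 seg(2) s by simp
next
  case (Suc i)
  let ?T = "{c - y..e - y}"
  have "((\<lambda>t. g i ((x, y) + t *\<^sub>R (0, 1))) has_real_derivative g (Suc i) (x, y)) (at 0 within ?T)"
    by (rule DERIV_subset[OF gS]) (use Suc.prems seg(2) in auto)
  then have "((\<lambda>t. poly ((pderiv ^^ i) q) (y + t)) has_real_derivative g (Suc i) (x, y)) (at 0 within ?T)"
    by (rule has_field_derivative_transform_within[of _ _ _ _ 1]) (use Suc in auto)
  moreover have "((\<lambda>t. poly ((pderiv ^^ i) q) (y + t)) has_real_derivative
      poly (pderiv ((pderiv ^^ i) q)) (y + 0)) (at 0 within ?T)"
    by (rule has_field_derivative_at_within) (auto intro!: derivative_eq_intros)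
  moreover have "at 0 within ?T \<noteq> bot"
    using seg(1) Suc.prems by (simp add: trivial_limit_within)
  ultimately show ?case
    using has_field_derivative_unique by fastforce
qed

text \<open>
  On each vertical line that meets both cells, the difference of the two polynomials has all derivatives
  of order below \<open>d\<close> zero at the height of \<open>p\<close>. There are infinitely many such lines, and both sides are
  polynomials in \<open>x\<close>.
\<close>

lemma (in box_mesh) smooth_jump:
  assumes "d \<ge> 1" "C_dir (d - 1) (0, 1) (\<Union>M) s"
    and F: "\<And>K. K \<in> M \<Longrightarrow> bipoly d (F K)" "\<And>K x y. K \<in> M \<Longrightarrow> (x, y) \<in> K \<Longrightarrow> s (x, y) = F K x y"
    and q: "quadrant M \<sigma> True p K" "quadrant M \<sigma> False p K'"
  shows "F K x y - F K' x y = (F K x (snd p + 1) - F K' x (snd p + 1)) * (y - snd p) ^ d"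
proof -
  obtain x0 y0 where p: "p = (x0, y0)" by (cases p)
  from q(1) obtain a b c e where
    K: "K = cbox (a, c) (b, e)" "K \<in> M" "germ_in \<sigma> x0 a b" "germ_in True y0 c e"
    unfolding quadrant_def p by auto
  from q(2) obtain a' b' c' e' where
    K': "K' = cbox (a', c') (b', e')" "K' \<in> M" "germ_in \<sigma> x0 a' b'" "germ_in False y0 c' e'"
    unfolding quadrant_def p by auto
  from assms(2) obtain g where g: "\<And>q. q \<in> \<Union>M \<Longrightarrow> g 0 q = s q"
    "\<And>i q. i < d - 1 \<Longrightarrow> q \<in> \<Union>M \<Longrightarrow> ((\<lambda>t. g i (q + t *\<^sub>R (0, 1))) has_real_derivative g (Suc i) q)
        (at 0 within {t. q + t *\<^sub>R (0, 1) \<in> \<Union>M})"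
    unfolding C_dir_def by metis
  have common: "F K x y - F K' x y = (F K x (y0 + 1) - F K' x (y0 + 1)) * (y - y0) ^ d"
    if x: "max a a' \<le> x" "x \<le> min b b'" for x y
  proof -
    obtain P where P: "degree P \<le> d" "\<And>y. F K x y = poly P y"
      using F(1)[OF K(2)] unfolding bipoly_def poly_fun_def by blast
    obtain P' where P': "degree P' \<le> d" "\<And>y. F K' x y = poly P' y"
      using F(1)[OF K'(2)] unfolding bipoly_def poly_fun_def by blast
    have inK: "(x, y) \<in> K" if "c \<le> y" "y \<le> e" for y
      using that x by (simp add: K(1))
    have inK': "(x, y) \<in> K'" if "c' \<le> y" "y \<le> e'" for y
      using that x by (simp add: K'(1))
    have "poly ((pderiv ^^ i) (P - P')) y0 = 0" if "i < d" for i
    proof -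
      have "g i (x, y0) = poly ((pderiv ^^ i) P) y0"
      proof (rule directional_derivatives_poly[of "\<Union>M" g s "d - 1" c e])
        show "s (x, y) = poly P y" if "c \<le> y" "y \<le> e" for y
          using F(2)[OF K(2) inK[OF that]] P(2) by simp
        show "(x, y) \<in> \<Union>M" if "c \<le> y" "y \<le> e" for y
          using inK[OF that] K(2) by blast
      qed (use g that germ_in_mem[OF K(4)] in auto)
      moreover have "g i (x, y0) = poly ((pderiv ^^ i) P') y0"
      proof (rule directional_derivatives_poly[of "\<Union>M" g s "d - 1" c' e'])
        show "s (x, y) = poly P' y" if "c' \<le> y" "y \<le> e'" for y
          using F(2)[OF K'(2) inK'[OF that]] P'(2) by simp
        show "(x, y) \<in> \<Union>M" if "c' \<le> y" "y \<le> e'" for y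
          using inK'[OF that] K'(2) by blast
      qed (use g that germ_in_mem[OF K'(4)] in auto)
      moreover have "(pderiv ^^ i) (P - P') = (pderiv ^^ i) P - (pderiv ^^ i) P'"
        by (induction i) (simp_all add: pderiv_diff)
      ultimately show ?thesis by simp
    qed
    then obtain r where r: "P - P' = smult r ([:- y0, 1:] ^ d)"
      using poly_shifted_monomial[of "P - P'" d y0] degree_diff_le[OF P(1) P'(1)] by blast
    then have "F K x y - F K' x y = r * (y - y0) ^ d" for y
    proof -
      have "F K x y - F K' x y = poly (P - P') y"
        by (simp add: P(2) P'(2))
      also have "\<dots> = r * (y - y0) ^ d"
        unfolding r by (simp add: poly_power)
      finally show ?thesis .
    qed
    from this[of y] this[of "y0 + 1"] show ?thesis by simp
  qed
  have "F K x y - F K' x y - (F K x (y0 + 1) - F K' x (y0 + 1)) * (y - y0) ^ d = 0"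
  proof (rule poly_fun_zero_infinite[where f = "\<lambda>x. F K x y - F K' x y - (F K x (y0 + 1) - F K' x (y0 + 1)) * (y - y0) ^ d"])
    show "poly_fun d (\<lambda>x. F K x y - F K' x y - (F K x (y0 + 1) - F K' x (y0 + 1)) * (y - y0) ^ d)"
      using F(1)[OF K(2)] F(1)[OF K'(2)] unfolding bipoly_def
      by (intro poly_fun_minus poly_fun_scale) auto
    show "infinite {max a a'..min b b'}"
      using germ_in_overlap[OF K(3) K'(3)] by (rule infinite_Icc)
    show "F K x y - F K' x y - (F K x (y0 + 1) - F K' x (y0 + 1)) * (y - y0) ^ d = 0"
      if "x \<in> {max a a'..min b b'}" for x
      using common[of x y] that by simp
  qed
  then show ?thesis
    by (simp add: p)
qed

text \<open>
  The polynomial on a cell has to be evaluated outside the cell. Since cells have interior points, the choice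
  is unique, which makes it linear in \<open>s\<close>.
\<close>

definition cell_poly ::
    "nat \<Rightarrow> (real \<times> real \<Rightarrow> real) \<Rightarrow> (real \<times> real) set \<Rightarrow> real \<Rightarrow> real \<Rightarrow> real" where
  "cell_poly d s K = (SOME f. bipoly d f \<and> (\<forall>(x, y)\<in>K. s (x, y) = f x y))"

lemma cell_poly:
  assumes "bidegree_poly_on d K s"
  shows "bipoly d (cell_poly d s K)" "(x, y) \<in> K \<Longrightarrow> s (x, y) = cell_poly d s K x y"
proof -
  obtain a where "\<forall>(x, y)\<in>K. s (x, y) = (\<Sum>i\<le>d. \<Sum>j\<le>d. a i j * x ^ i * y ^ j)"
    using assms unfolding bidegree_poly_on_def by blast
  then have "\<exists>f. bipoly d f \<and> (\<forall>(x, y)\<in>K. s (x, y) = f x y)"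
    using bipoly_sum by blast
  then have "bipoly d (cell_poly d s K) \<and> (\<forall>(x, y)\<in>K. s (x, y) = cell_poly d s K x y)"
    unfolding cell_poly_def by (rule someI_ex)
  then show "bipoly d (cell_poly d s K)" "(x, y) \<in> K \<Longrightarrow> s (x, y) = cell_poly d s K x y"
    by auto
qed

lemma C_dir_flip:
  assumes "C_dir k (1, 0) \<Phi> s"
  shows "C_dir k (0, 1) (flip \<Phi>) (s \<circ> prod.swap)"
proof -
  obtain g where g: "\<And>p. p \<in> \<Phi> \<Longrightarrow> g 0 p = s p" "\<And>i. i \<le> k \<Longrightarrow> continuous_on \<Phi> (g i)"
    "\<And>i p. i < k \<Longrightarrow> p \<in> \<Phi> \<Longrightarrow> ((\<lambda>t. g i (p + t *\<^sub>R (1, 0))) has_real_derivative g (Suc i) p)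
        (at 0 within {t. p + t *\<^sub>R (1, 0) \<in> \<Phi>})"
    using assms unfolding C_dir_def by metis
  have move: "prod.swap (p + t *\<^sub>R (0, 1)) = prod.swap p + t *\<^sub>R (1, 0)" for p :: "real \<times> real" and t :: real
    by (cases p) simp
  show ?thesis
    unfolding C_dir_def
  proof (intro exI[of _ "\<lambda>i. g i \<circ> prod.swap"] conjI allI impI ballI)
    show "continuous_on (flip \<Phi>) (g i \<circ> prod.swap)" if "i \<le> k" for i
      using g(2)[OF that] continuous_on_swap by (intro continuous_on_compose) simp_all
    show "((\<lambda>t. (g i \<circ> prod.swap) (p + t *\<^sub>R (0, 1))) has_real_derivative (g (Suc i) \<circ> prod.swap) p)
        (at 0 within {t. p + t *\<^sub>R (0, 1) \<in> flip \<Phi>})" if "i < k" "p \<in> flip \<Phi>" for i p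
      using g(3)[OF that(1), of "prod.swap p"] that(2) unfolding mem_flip o_def move by (simp only:)
  qed (use g(1) in \<open>auto simp: mem_flip\<close>)
qed

lemma spline_jumps_cell_poly:
  assumes "box_mesh M" "d \<ge> 1" "s \<in> spline_space d M"
  shows "spline_jumps M d (cell_poly d s)"
proof -
  interpret box_mesh M by fact
  interpret T: box_mesh "flip ` M"
    by (rule box_mesh_flip) fact
  have smooth: "C_dir (d - 1) (1, 0) (\<Union>M) s" "C_dir (d - 1) (0, 1) (\<Union>M) s"
    and "\<And>K. K \<in> M \<Longrightarrow> bidegree_poly_on d K s"
    using assms(3) by (auto simp: spline_space_def)
  note P = cell_poly[OF this(3)]
  show ?thesis
  proof
    fix \<sigma> p K K' and x y :: real
    assume "quadrant M \<sigma> True p K" "quadrant M \<sigma> False p K'"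
    with smooth(2) P show "cell_poly d s K x y - cell_poly d s K' x y =
        (cell_poly d s K x (snd p + 1) - cell_poly d s K' x (snd p + 1)) * (y - snd p) ^ d"
      by (intro smooth_jump[OF assms(2)])
  next
    fix \<tau> p K K' and x y :: real
    assume q: "quadrant M True \<tau> p K" "quadrant M False \<tau> p K'"
    let ?F = "\<lambda>K x y. cell_poly d s (flip K) y x"
    have "C_dir (d - 1) (0, 1) (\<Union>(flip ` M)) (s \<circ> prod.swap)"
      unfolding Union_flip using smooth(1) by (rule C_dir_flip)
    moreover have "bipoly d (?F K)" if "K \<in> flip ` M" for K
      using P(1) that by (auto simp: bipoly_def)
    moreover have "(s \<circ> prod.swap) (x, y) = ?F K x y" if "K \<in> flip ` M" "(x, y) \<in> K" for K x y
      using P(2) that by (auto simp: mem_flip)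
    moreover have "quadrant (flip ` M) \<tau> True (prod.swap p) (flip K)"
      "quadrant (flip ` M) \<tau> False (prod.swap p) (flip K')"
      using q by (auto intro: quadrant_flip)
    ultimately have "?F (flip K) y x - ?F (flip K') y x =
        (?F (flip K) y (snd (prod.swap p) + 1) - ?F (flip K') y (snd (prod.swap p) + 1)) * (x - snd (prod.swap p)) ^ d"
      by (rule T.smooth_jump[OF assms(2)])
    then show "cell_poly d s K x y - cell_poly d s K' x y =
        (cell_poly d s K (fst p + 1) y - cell_poly d s K' (fst p + 1) y) * (x - fst p) ^ d"
      by simp
  qed
qed

lemma cell_poly_lincomb:
  assumes "box_mesh M" "K \<in> M" "s \<in> spline_space d M" "t \<in> spline_space d M"
  shows "cell_poly d (\<lambda>p. \<alpha> * s p + \<beta> * t p) K x y = \<alpha> * cell_poly d s K x y + \<beta> * cell_poly d t K x y"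
proof -
  interpret box_mesh M by fact
  obtain a b c e where abce: "a < b" "c < e" "K = cbox (a, c) (b, e)"
    using boxes[OF assms(2)] by blast
  have "bidegree_poly_on d K s" "bidegree_poly_on d K t"
    using assms by (auto simp: spline_space_def)
  note P = cell_poly[OF this(1)] cell_poly[OF this(2)] cell_poly[OF bidegree_poly_on_lincomb[OF this, of \<alpha> \<beta>]]
  show ?thesis
    by (rule bipoly_eq_on_box[OF P(5) bipoly_lincomb[OF P(1,3)] abce(1,2)])
       (use P(2,4,6) abce(3) in auto)
qed

text \<open>
  Without kinks, the polynomials of all cells that contain a given interior point coincide: one can pass
  between any two quadrants by way of an adjacent one. So the union of the cells with zero polynomial and the
  union of the other cells are closed and have no interior point of the domain in common.
\<close>

lemma (in spline_jumps) cells_agree: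
  assumes conn: "connected (interior (\<Union>M))"
    and kink_y: "\<And>p \<sigma> x. p \<in> interior (\<Union>M) \<Longrightarrow> kink M F \<sigma> p x = 0"
    and kink_x: "\<And>p \<sigma> x. p \<in> flip (interior (\<Union>M)) \<Longrightarrow>
      kink (flip ` M) (\<lambda>K x y. F (flip K) y x) \<sigma> p x = 0"
    and K0: "K0 \<in> M" "\<And>x y. F K0 x y = 0" and K: "K \<in> M"
  shows "F K x y = 0"
proof -
  interpret T: spline_jumps "flip ` M" d "\<lambda>K x y. F (flip K) y x"
    by (rule spline_jumps_flip) (rule spline_jumps_axioms)
  have vert: "F L x y = F L' x y"
    if "p \<in> interior (\<Union>M)" "quadrant M \<sigma> True p L" "quadrant M \<sigma> False p L'" for p \<sigma> L L' x y
    using jump_y[OF that(2,3), of x y] kink_y[OF that(1), of \<sigma> x] kink_eq[OF that(2,3), of F x] by simp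
  have horiz: "F L x y = F L' x y"
    if "p \<in> interior (\<Union>M)" "quadrant M True \<tau> p L" "quadrant M False \<tau> p L'" for p \<tau> L L' x y
    using jump_x[OF that(2,3), of x y] kink_x[of "prod.swap p" \<tau> y] that(1)
      T.kink_eq[OF quadrant_flip[OF that(2)] quadrant_flip[OF that(3)], of "\<lambda>K x y. F (flip K) y x" y] by simp
  have near: "F L x y = F L' x y" if p: "p \<in> interior (\<Union>M)" "p \<in> L" "p \<in> L'" "L \<in> M" "L' \<in> M" for p L L' x y
  proof -
    obtain \<sigma> \<tau> \<sigma>' \<tau>' where q: "quadrant M \<sigma> \<tau> p L" "quadrant M \<sigma>' \<tau>' p L'"
      using quadrant_of_mem[OF p(4,2)] quadrant_of_mem[OF p(5,3)] by blast
    obtain N where N: "quadrant M \<sigma> \<tau>' p N"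
      using quadrant_exists[OF p(1)] by blast
    have "F L x y = F N x y"
    proof (cases "\<tau> = \<tau>'")
      case True
      then show ?thesis using quadrant_unique[OF q(1)] N by simp
    next
      case False
      then show ?thesis
        using vert[OF p(1), of \<sigma> L N x y] vert[OF p(1), of \<sigma> N L x y] q(1) N
        by (cases \<tau>; cases \<tau>') simp_all
    qed
    also have "F N x y = F L' x y"
    proof (cases "\<sigma> = \<sigma>'")
      case True
      then show ?thesis using quadrant_unique[OF q(2)] N by simp
    next
      case False
      then show ?thesis
        using horiz[OF p(1), of \<tau>' L' N x y] horiz[OF p(1), of \<tau>' N L' x y] q(2) N
        by (cases \<sigma>; cases \<sigma>') simp_all
    qed
    finally show ?thesis .
  qed
  define Z where "Z = {L \<in> M. \<forall>x y. F L x y = 0}"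
  have meets: "\<exists>p. p \<in> L \<and> p \<in> interior (\<Union>M)" if L: "L \<in> M" for L
  proof -
    obtain a b c e where abce: "a < b" "c < e" "L = cbox (a, c) (b, e)"
      using boxes[OF L] by blast
    have "((a + b) / 2, (c + e) / 2) \<in> interior L"
      using abce(1,2) unfolding abce(3) interior_cbox by (simp add: mem_box_pair)
    moreover have "interior L \<subseteq> interior (\<Union>M)" "interior L \<subseteq> L"
      using L interior_subset by (auto intro!: interior_mono)
    ultimately show ?thesis by blast
  qed
  have closed: "closed (\<Union>X)" if "X \<subseteq> M" for X
    using finite_subset[OF that fin] that closed_cell by (intro closed_Union) blast+
  have "\<Union>Z \<inter> interior (\<Union>M) = {} \<or> \<Union>(M - Z) \<inter> interior (\<Union>M) = {}"
  proof -
    have "\<Union>Z \<inter> \<Union>(M - Z) \<inter> interior (\<Union>M) = {}"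
    proof (rule ccontr)
      assume "\<not> ?thesis"
      then obtain p L L' where "p \<in> interior (\<Union>M)" "p \<in> L" "L \<in> Z" "p \<in> L'" "L' \<in> M" "L' \<notin> Z"
        by blast
      then show False
        using near[of p L L'] unfolding Z_def by simp
    qed
    moreover have "interior (\<Union>M) \<subseteq> \<Union>Z \<union> \<Union>(M - Z)"
      using interior_subset[of "\<Union>M"] by blast
    moreover have "closed (\<Union>Z)" "closed (\<Union>(M - Z))"
      by (rule closed; auto simp: Z_def)+
    ultimately show ?thesis
      by (rule connected_closedD[OF conn])
  qed
  moreover have "K0 \<in> Z"
    using K0 by (simp add: Z_def)
  ultimately have "\<Union>(M - Z) \<inter> interior (\<Union>M) = {}"
    using meets[OF K0(1)] by blast
  then have "K \<in> Z"
    using meets[OF K] K by blast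
  then show ?thesis by (simp add: Z_def)
qed

section \<open>T l-edges\<close>

lemma maximal_run_interior_l_edge: "l \<in> interior_l_edges M \<Longrightarrow> maximal_run M l"
  by (simp add: interior_l_edges_def maximal_run_def)

lemma maximal_run_T_l_edge: "l \<in> T_l_edges M \<Longrightarrow> maximal_run M l"
  by (simp add: T_l_edges_def maximal_run_interior_l_edge)

lemma maximal_run_orientation: "maximal_run M l \<Longrightarrow> horizontal l \<or> vertical l"
  by (auto simp: maximal_run_def interior_runs_def)

lemma maximal_runs_cross:
  assumes "maximal_run M l" "maximal_run M l'" "p \<in> l" "p \<in> l'" "l \<noteq> l'"
  shows "horizontal l \<and> vertical l' \<or> vertical l \<and> horizontal l'"
proof -
  have "\<not> (horizontal l \<and> horizontal l')"
    using maximal_horizontal_runs_disjoint[OF assms(1,2)] assms(3-5) by blast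
  moreover have "\<not> (vertical l \<and> vertical l')"
  proof
    assume "vertical l \<and> vertical l'"
    then have "flip l = flip l'"
      using assms(3,4) by (intro maximal_horizontal_runs_disjoint[OF maximal_run_flip[OF assms(1)] maximal_run_flip[OF assms(2)]] horizontal_flip) auto
    then have "l = l'" by (metis flip_flip)
    with assms(5) show False ..
  qed
  ultimately show ?thesis
    using assms(1,2) maximal_run_orientation by blast
qed

lemma T_l_edge_ends:
  assumes "l \<in> T_l_edges M"
  obtains u v where "l = closed_segment u v" "{u, v} \<subseteq> interior (\<Union>M)"
  using assms unfolding T_l_edges_def T_junctions_def interior_vertices_def by blast

text \<open>
  With the cofactors outside \<open>P\<close> removed, the relation along the run is a relation between at most \<open>d + 1\<close>
  powers with distinct centres.
\<close>

lemma (in spline_jumps) cofactors_vanish_horizontal: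
  assumes run: "maximal_run M l" "horizontal l" "l = closed_segment u v" "{u, v} \<subseteq> interior (\<Union>M)"
    and P: "P \<subseteq> interior_vertices M \<inter> l" "card P \<le> d + 1"
    and rest: "\<And>w. w \<in> interior_vertices M \<inter> l - P \<Longrightarrow> cofactor M F w = 0"
    and w: "w \<in> P"
  shows "cofactor M F w = 0"
proof -
  obtain \<alpha> \<beta> y where l: "\<alpha> < \<beta>" "l = closed_segment (\<alpha>, y) (\<beta>, y)"
    using run(2) unfolding horizontal_def by blast
  have "{u, v} = {(\<alpha>, y), (\<beta>, y)}"
    using hseg_eq_iff(1)[OF l(1)] l(2) run(3) by simp
  then have ends: "(\<alpha>, y) \<in> interior (\<Union>M)" "(\<beta>, y) \<in> interior (\<Union>M)"
    using run(4) by auto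
  note rel = run_relation[OF run(1)[unfolded l(2)] l(1) ends, folded l(2)]
  have V: "vertices M \<inter> l = interior_vertices M \<inter> l"
    using horizontal_run_subset_interior[OF run] by (auto simp: interior_vertices_def)
  show ?thesis
  proof (rule shifted_powers_independent[where Q = P and d = d and t = fst])
    show "finite P"
      using finite_subset[of P "vertices M"] P(1) finite_vertices by (auto simp: interior_vertices_def)
    show "inj_on fst P"
      using P(1) l by (auto intro!: inj_onI simp: mem_closed_hseg prod_eq_iff subset_iff)
    show "(\<Sum>v\<in>P. cofactor M F v * (x - fst v) ^ d) = 0" for x
    proof -
      have "(\<Sum>v\<in>vertices M \<inter> l. cofactor M F v * (x - fst v) ^ d) = (\<Sum>v\<in>P. cofactor M F v * (x - fst v) ^ d)"
        using P(1) rest finite_vertices unfolding V[symmetric]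
        by (intro sum.mono_neutral_right) auto
      then show ?thesis
        using rel by simp
    qed
  qed (use P(2) w in auto)
qed

lemma (in spline_jumps) cofactors_vanish:
  assumes l: "l \<in> T_l_edges M"
    and P: "P \<subseteq> interior_vertices M \<inter> l" "card P \<le> d + 1"
    and rest: "\<And>w. w \<in> interior_vertices M \<inter> l - P \<Longrightarrow> cofactor M F w = 0"
    and w: "w \<in> P"
  shows "cofactor M F w = 0"
proof -
  let ?G = "\<lambda>K x y. F (flip K) y x"
  interpret T: spline_jumps "flip ` M" d ?G
    by (rule spline_jumps_flip) (rule spline_jumps_axioms)
  obtain u v where uv: "l = closed_segment u v" "{u, v} \<subseteq> interior (\<Union>M)"
    using l by (rule T_l_edge_ends)
  note run = maximal_run_T_l_edge[OF l]
  have int: "interior_vertices M \<subseteq> interior (\<Union>M)"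
    by (simp add: interior_vertices_def)
  show ?thesis
  proof (cases "horizontal l")
    case True
    show ?thesis
      by (rule cofactors_vanish_horizontal[OF run True uv P rest w])
  next
    case False
    then have "horizontal (flip l)"
      using run maximal_run_orientation horizontal_flip by blast
    have "cofactor (flip ` M) ?G (prod.swap w) = 0"
    proof (rule T.cofactors_vanish_horizontal[OF maximal_run_flip[OF run] \<open>horizontal (flip l)\<close>])
      show "flip l = closed_segment (prod.swap u) (prod.swap v)"
        by (simp add: uv(1) closed_segment_flip)
      show "{prod.swap u, prod.swap v} \<subseteq> interior (\<Union>(flip ` M))"
        using uv(2) by (simp add: Union_flip interior_flip)
      show "flip P \<subseteq> interior_vertices (flip ` M) \<inter> flip l"
        using P(1) by (auto simp: interior_vertices_flip)
      show "card (flip P) \<le> d + 1"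
        using P(2) by (simp add: card_image inj_swap)
      show "prod.swap w \<in> flip P"
        using w by simp
      show "cofactor (flip ` M) ?G q = 0" if "q \<in> interior_vertices (flip ` M) \<inter> flip l - flip P" for q
      proof -
        have "prod.swap q \<in> interior_vertices M \<inter> l - P"
          using that by (auto simp: interior_vertices_flip mem_flip)
        then show ?thesis
          using rest[of "prod.swap q"] cofactor_flip[OF box_mesh_axioms, of "prod.swap q" F] int by auto
      qed
    qed
    then show ?thesis
      using cofactor_flip[OF box_mesh_axioms, of w F] int P(1) w by auto
  qed
qed

lemma (in box_mesh) T_l_edge_vertices:
  assumes "l \<in> T_l_edges M"
  shows "vertices M \<inter> l = interior_vertices M \<inter> l"
proof -
  interpret T: box_mesh "flip ` M"
    by (rule box_mesh_flip) (rule box_mesh_axioms)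
  obtain u v where uv: "l = closed_segment u v" "{u, v} \<subseteq> interior (\<Union>M)"
    using assms by (rule T_l_edge_ends)
  note run = maximal_run_T_l_edge[OF assms]
  have "l \<subseteq> interior (\<Union>M)"
  proof (cases "horizontal l")
    case True
    show ?thesis
      by (rule horizontal_run_subset_interior[OF run True uv])
  next
    case False
    then have "horizontal (flip l)"
      using run maximal_run_orientation horizontal_flip by blast
    then have "flip l \<subseteq> interior (\<Union>(flip ` M))"
      using T.horizontal_run_subset_interior[OF maximal_run_flip[OF run], of "prod.swap u" "prod.swap v"] uv
      by (simp add: Union_flip interior_flip closed_segment_flip)
    then show ?thesis
      by (simp add: Union_flip interior_flip inj_image_subset_iff[OF inj_swap])
  qed
  then show ?thesis
    by (auto simp: interior_vertices_def)
qed

section \<open>Functionals that determine a spline\<close>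

definition cut_point :: "(real \<times> real) set set \<Rightarrow> (real \<times> real) set \<Rightarrow> real \<times> real" where
  "cut_point M l = (SOME p. p \<in> l \<inter> interior (\<Union>M))"

text \<open>
  The functionals that determine a spline. A polynomial of degree at most \<open>d\<close> is recorded by its values at
  \<open>0, \<dots>, d\<close>; this applies to the polynomial on the cell \<open>K0\<close> and to the kink at one point of each cross-cut.
\<close>

fun spline_functional ::
    "nat \<Rightarrow> (real \<times> real) set set \<Rightarrow> (real \<times> real) set \<Rightarrow>
     (nat \<times> nat) + ((real \<times> real) set \<times> nat) + (real \<times> real) \<Rightarrow> (real \<times> real \<Rightarrow> real) \<Rightarrow> real" where
  "spline_functional d M K0 (Inl (i, j)) s = cell_poly d s K0 (real i) (real j)"
| "spline_functional d M K0 (Inr (Inl (l, k))) s =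
    (if horizontal l then kink M (cell_poly d s) True (cut_point M l) (real k)
     else kink (flip ` M) (\<lambda>K x y. cell_poly d s (flip K) y x) True (prod.swap (cut_point M l)) (real k))"
| "spline_functional d M K0 (Inr (Inr v)) s = cofactor M (cell_poly d s) v"

lemma (in box_mesh) cut_point:
  assumes "l \<in> interior_runs M"
  shows "cut_point M l \<in> l" "cut_point M l \<in> interior (\<Union>M)"
proof -
  have "cut_point M l \<in> l \<inter> interior (\<Union>M)"
    unfolding cut_point_def using run_meets_interior[OF assms] some_in_eq by blast
  then show "cut_point M l \<in> l" "cut_point M l \<in> interior (\<Union>M)"
    by auto
qed

lemma (in box_mesh) kink_lincomb:
  assumes "p \<in> interior (\<Union>M)"
    and "\<And>K x y. K \<in> M \<Longrightarrow> H K x y = a * F K x y + b * G K x y"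
  shows "kink M H \<sigma> p x = a * kink M F \<sigma> p x + b * kink M G \<sigma> p x"
  unfolding kink_def using assms(2) quadrant_mem(1)[OF quadrant_cell[OF assms(1)]]
  by (simp add: algebra_simps)

lemma spline_functional_linear:
  assumes "box_mesh M" "K0 \<in> M" "s \<in> spline_space d M" "t \<in> spline_space d M"
    and i: "i \<in> ({..d} \<times> {..d}) <+> (cross_cuts M \<times> {..d}) <+> interior_vertices M"
  shows "spline_functional d M K0 i (\<lambda>p. a * s p + b * t p) =
    a * spline_functional d M K0 i s + b * spline_functional d M K0 i t"
proof -
  interpret box_mesh M by fact
  interpret T: box_mesh "flip ` M"
    by (rule box_mesh_flip) fact
  note lin = cell_poly_lincomb[OF assms(1) _ assms(3,4), where \<alpha> = a and \<beta> = b]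
  note kink_lin = kink_lincomb[where F = "cell_poly d s" and G = "cell_poly d t"
      and H = "cell_poly d (\<lambda>p. a * s p + b * t p)", OF _ lin]
  from i consider (base) j k where "i = Inl (j, k)"
    | (cut) l k where "i = Inr (Inl (l, k))" "l \<in> cross_cuts M"
    | (vertex) v where "i = Inr (Inr v)" "v \<in> interior_vertices M"
    by auto
  then show ?thesis
  proof cases
    case base
    then show ?thesis using lin[OF assms(2)] by simp
  next
    case cut
    then have run: "l \<in> interior_runs M"
      by (simp add: cross_cuts_def interior_l_edges_def)
    note p = cut_point(2)[OF run]
    then have "prod.swap (cut_point M l) \<in> interior (\<Union>(flip ` M))"
      by (simp add: Union_flip interior_flip)
    moreover have "cell_poly d (\<lambda>p. a * s p + b * t p) (flip K) y x =
        a * cell_poly d s (flip K) y x + b * cell_poly d t (flip K) y x" if "K \<in> flip ` M" for K x y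
      using that by (intro lin) auto
    ultimately show ?thesis
      using cut(1) kink_lin[OF p] T.kink_lincomb[of "prod.swap (cut_point M l)"
          "\<lambda>K x y. cell_poly d (\<lambda>p. a * s p + b * t p) (flip K) y x" a
          "\<lambda>K x y. cell_poly d s (flip K) y x" b "\<lambda>K x y. cell_poly d t (flip K) y x"]
      by simp
  next
    case vertex
    then have "v \<in> interior (\<Union>M)"
      by (simp add: interior_vertices_def)
    from kink_lin[OF this] vertex(1) show ?thesis
      by (simp add: cofactor_def algebra_simps)
  qed
qed

lemma (in box_mesh) kink_zero_nat:
  assumes "\<And>K. K \<in> M \<Longrightarrow> bipoly d (F K)" "p \<in> interior (\<Union>M)"
    and "\<And>k. k \<le> d \<Longrightarrow> kink M F \<sigma> p (real k) = 0"
  shows "kink M F \<sigma> p x = 0"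
proof (rule poly_fun_zero_nat[of d "kink M F \<sigma> p" x, OF _ assms(3)])
  have "bipoly d (F (quadrant_cell M \<sigma> \<tau> p))" for \<tau>
    using assms(1) quadrant_mem(1)[OF quadrant_cell[OF assms(2)]] .
  then show "poly_fun d (kink M F \<sigma> p)"
    unfolding kink_def bipoly_def by (intro poly_fun_minus) blast+
qed

lemma cross_cut_if_boundary_run:
  assumes "maximal_run M l" "l = closed_segment u v" "{u, v} \<subseteq> boundary_vertices M"
  shows "l \<in> cross_cuts M"
  using assms unfolding cross_cuts_def interior_l_edges_def maximal_run_def by blast

text \<open>
  Here the two directions come together: the kinks across horizontal lines vanish because of the horizontal
  cross-cuts, and those across vertical lines by the same argument for the transposed mesh.
\<close>

lemma spline_zero_if_functionals_vanish:
  assumes mesh: "T_mesh M" and d: "d \<ge> 1" and s: "s \<in> spline_space d M" and K0: "K0 \<in> M"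
    and cof: "\<And>v. v \<in> interior_vertices M \<Longrightarrow> cofactor M (cell_poly d s) v = 0"
    and base: "\<And>i j. i \<le> d \<Longrightarrow> j \<le> d \<Longrightarrow> spline_functional d M K0 (Inl (i, j)) s = 0"
    and cuts: "\<And>l k. l \<in> cross_cuts M \<Longrightarrow> k \<le> d \<Longrightarrow> spline_functional d M K0 (Inr (Inl (l, k))) s = 0"
  shows "s = (\<lambda>p. 0)"
proof -
  let ?F = "cell_poly d s"
  let ?G = "\<lambda>K x y. ?F (flip K) y x"
  interpret box_mesh M
    using mesh by (rule box_mesh_T_mesh)
  interpret spline_jumps M d ?F
    by (rule spline_jumps_cell_poly[OF _ d s]) (rule box_mesh_axioms)
  interpret T: spline_jumps "flip ` M" d ?G
    by (rule spline_jumps_flip) (rule spline_jumps_axioms)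
  have "bidegree_poly_on d K s" if "K \<in> M" for K
    using s that by (simp add: spline_space_def)
  note P = cell_poly[OF this]
  have "kink M ?F \<sigma> p x = 0" if "p \<in> interior (\<Union>M)" for p \<sigma> x
  proof (rule kinks_vanish[OF cof _ that])
    fix l u v
    assume l: "maximal_run M l" "horizontal l" "l = closed_segment u v" "{u, v} \<subseteq> boundary_vertices M"
    then have run: "l \<in> interior_runs M"
      by (simp add: maximal_run_def)
    have cut: "l \<in> cross_cuts M"
      by (rule cross_cut_if_boundary_run[OF l(1,3,4)])
    have "kink M ?F True (cut_point M l) x = 0" for x
    proof (rule kink_zero_nat[OF P(1) cut_point(2)[OF run]])
      show "kink M ?F True (cut_point M l) (real k) = 0" if "k \<le> d" for k
        using cuts[OF cut that] l(2) by simp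
    qed
    then show "\<exists>q\<in>l \<inter> interior (\<Union>M). \<forall>x. kink M ?F True q x = 0"
      using cut_point[OF run] by blast
  qed
  moreover have "kink (flip ` M) ?G \<sigma> p x = 0" if "p \<in> interior (\<Union>(flip ` M))" for p \<sigma> x
  proof (rule T.kinks_vanish[OF _ _ that])
    show "cofactor (flip ` M) ?G v = 0" if "v \<in> interior_vertices (flip ` M)" for v
    proof -
      have v: "prod.swap v \<in> interior_vertices M"
        using that by (simp add: interior_vertices_flip mem_flip)
      then have "prod.swap v \<in> interior (\<Union>M)"
        by (simp add: interior_vertices_def)
      from cofactor_flip[OF box_mesh_axioms this, of ?F] cof[OF v] show ?thesis
        by simp
    qed
    fix l u v
    assume l: "maximal_run (flip ` M) l" "horizontal l" "l = closed_segment u v"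
      "{u, v} \<subseteq> boundary_vertices (flip ` M)"
    have run: "maximal_run M (flip l)"
      using maximal_run_flip[OF l(1)] by simp
    then have runs: "flip l \<in> interior_runs M"
      by (simp add: maximal_run_def)
    have "flip l = closed_segment (prod.swap u) (prod.swap v)"
      by (simp add: l(3) closed_segment_flip)
    moreover have "{prod.swap u, prod.swap v} \<subseteq> boundary_vertices M"
      using l(4) by (simp add: boundary_vertices_flip mem_flip)
    ultimately have cut: "flip l \<in> cross_cuts M"
      by (rule cross_cut_if_boundary_run[OF run])
    have "\<not> horizontal (flip l)"
      using vertical_flip[OF l(2)] not_horizontal_and_vertical by blast
    let ?q = "prod.swap (cut_point M (flip l))"
    have q: "?q \<in> l" "?q \<in> interior (\<Union>(flip ` M))"
      using cut_point[OF runs] by (simp_all add: Union_flip interior_flip mem_flip)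
    have "kink (flip ` M) ?G True ?q x = 0" for x
    proof (rule T.kink_zero_nat[OF _ q(2)])
      show "bipoly d (?G K)" if "K \<in> flip ` M" for K
        using that P(1) by (auto simp: bipoly_def)
      show "kink (flip ` M) ?G True ?q (real k) = 0" if "k \<le> d" for k
        using cuts[OF cut that] \<open>\<not> horizontal (flip l)\<close> by simp
    qed
    with q show "\<exists>q\<in>l \<inter> interior (\<Union>(flip ` M)). \<forall>x. kink (flip ` M) ?G True q x = 0"
      by blast
  qed
  moreover have "connected (interior (\<Union>M))"
    using mesh by (simp add: T_mesh_def)
  moreover have "?F K0 x y = 0" for x y
    by (rule bipoly_zero_nat[OF P(1)[OF K0]]) (use base in simp)
  ultimately have zero: "?F K x y = 0" if "K \<in> M" for K x y
    using cells_agree[OF _ _ _ K0 _ that] by (simp add: Union_flip interior_flip)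
  show ?thesis
  proof
    fix p
    show "s p = 0"
    proof (cases "p \<in> \<Union>M")
      case True
      then obtain K where "K \<in> M" "p \<in> K" by blast
      then show ?thesis
        using P(2)[of K "fst p" "snd p"] zero[of K] by simp
    next
      case False
      then show ?thesis
        using s unfolding spline_space_def by blast
    qed
  qed
qed

section \<open>The dimension bound\<close>

text \<open>
  Each functional cuts out a subspace of codimension at most one, so one vector per functional is enough to
  span the space. Linearity on \<open>V\<close> only.
\<close>

lemma (in vector_space) spanned_by_few_if_functionals_separate:
  fixes f :: "'i \<Rightarrow> 'b \<Rightarrow> 'a"
  assumes "finite I" "subspace V"
    and "\<And>i x y a b. i \<in> I \<Longrightarrow> x \<in> V \<Longrightarrow> y \<in> V \<Longrightarrow> f i (a *s x + b *s y) = a * f i x + b * f i y"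
    and "\<And>x. x \<in> V \<Longrightarrow> (\<And>i. i \<in> I \<Longrightarrow> f i x = 0) \<Longrightarrow> x = 0"
  shows "\<exists>W. finite W \<and> card W \<le> card I \<and> V \<subseteq> span W"
  using assms
proof (induction I arbitrary: V rule: finite_induct)
  case empty
  then have "V \<subseteq> span {}" by auto
  then show ?case by (intro exI[of _ "{}"]) simp
next
  case (insert j J)
  note lin = insert.prems(2)[of j, simplified]
  define V' where "V' = {x \<in> V. f j x = 0}"
  have comb: "a *s x + b *s y \<in> V" if "x \<in> V" "y \<in> V" for a b x y
    using insert.prems(1) that by (intro subspace_add subspace_scale)
  have "subspace V'"
  proof (rule subspaceI)
    show "0 \<in> V'"
      using subspace_0[OF insert.prems(1)] lin[of 0 0 0 0] by (simp add: V'_def)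
    show "x + y \<in> V'" if "x \<in> V'" "y \<in> V'" for x y
      using comb[of x y 1 1] lin[of x y 1 1] that by (simp add: V'_def)
    show "c *s x \<in> V'" if "x \<in> V'" for c x
      using comb[of x x c 0] lin[of x x c 0] that by (simp add: V'_def)
  qed
  moreover have "x = 0" if "x \<in> V'" "\<And>i. i \<in> J \<Longrightarrow> f i x = 0" for x
    using insert.prems(3)[of x] that by (auto simp: V'_def)
  ultimately obtain W where W: "finite W" "card W \<le> card J" "V' \<subseteq> span W"
    using insert.IH[of V'] insert.prems(2) by (auto simp: V'_def)
  show ?case
  proof (cases "V' = V")
    case True
    then show ?thesis
      using W insert.hyps by (intro exI[of _ W]) auto
  next
    case False
    then obtain v where v: "v \<in> V" "f j v \<noteq> 0"
      by (auto simp: V'_def)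
    have "x \<in> span (insert v W)" if "x \<in> V" for x
    proof -
      define k where "k = f j x / f j v"
      have eq: "1 *s x + (- k) *s v = x - k *s v"
        by (simp add: scale_minus_left)
      have "x - k *s v \<in> V'"
        using comb[OF that v(1), of 1 "- k"] lin[OF that v(1), of 1 "- k"] v(2)
        unfolding eq by (simp add: V'_def k_def)
      then show ?thesis
        using W(3) unfolding span_breakdown_eq by blast
    qed
    moreover have "card (insert v W) \<le> card (insert j J)"
      using W insert.hyps by (simp add: card_insert_if)
    ultimately show ?thesis
      using W(1) by (intro exI[of _ "insert v W"]) auto
  qed
qed

text \<open>
  Think of \<open>Z\<close> as the set of points where some unknown function vanishes, and of the condition on the sets \<open>l\<close>
  in \<open>L\<close> as saying that on \<open>l\<close> any \<open>k\<close> values follow from the other values on \<open>l\<close>. Then the values on \<open>Q\<close>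
  are redundant. The pivots of a new set \<open>l\<close> are chosen off the earlier sets; the values on these
  are known by the time \<open>l\<close> is treated.
\<close>

lemma pivots_exist:
  fixes L :: "'v set list"
  assumes "finite V"
  shows "\<exists>Q \<subseteq> V \<inter> \<Union>(set L).
    card Q = (\<Sum>i<length L. min k (card (V \<inter> L ! i - \<Union>(set (take i L))))) \<and>
    (\<forall>Z. (\<forall>l\<in>set L. \<forall>P \<subseteq> V \<inter> l. card P \<le> k \<longrightarrow> V \<inter> l - P \<subseteq> Z \<longrightarrow> P \<subseteq> Z) \<longrightarrow>
      V \<inter> \<Union>(set L) - Q \<subseteq> Z \<longrightarrow> V \<inter> \<Union>(set L) \<subseteq> Z)"
proof (induction L rule: rev_induct)
  case Nil
  show ?case by simp
next
  case (snoc l L)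
  let ?R = "V \<inter> l - \<Union>(set L)"
  from snoc obtain Q where Q: "Q \<subseteq> V \<inter> \<Union>(set L)"
    "card Q = (\<Sum>i<length L. min k (card (V \<inter> L ! i - \<Union>(set (take i L)))))"
    "\<And>Z. (\<forall>l\<in>set L. \<forall>P \<subseteq> V \<inter> l. card P \<le> k \<longrightarrow> V \<inter> l - P \<subseteq> Z \<longrightarrow> P \<subseteq> Z) \<Longrightarrow>
      V \<inter> \<Union>(set L) - Q \<subseteq> Z \<Longrightarrow> V \<inter> \<Union>(set L) \<subseteq> Z"
    by metis
  obtain P where P: "P \<subseteq> ?R" "card P = min k (card ?R)"
    using obtain_subset_with_card_n[of "min k (card ?R)" ?R] by (metis min.cobounded2)
  have fin: "finite Q" "finite P"
    using finite_subset[OF _ assms] Q(1) P(1) by blast+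
  show ?case
  proof (intro exI[of _ "Q \<union> P"] conjI allI impI)
    show "Q \<union> P \<subseteq> V \<inter> \<Union>(set (L @ [l]))"
      using Q(1) P(1) by auto
    have "card (Q \<union> P) = card Q + card P"
      using Q(1) P(1) fin by (intro card_Un_disjoint) auto
    also have "\<dots> = (\<Sum>i<length (L @ [l]). min k (card (V \<inter> (L @ [l]) ! i - \<Union>(set (take i (L @ [l]))))))"
      unfolding Q(2) P(2) by (simp add: nth_append)
    finally show "card (Q \<union> P) =
        (\<Sum>i<length (L @ [l]). min k (card (V \<inter> (L @ [l]) ! i - \<Union>(set (take i (L @ [l]))))))" .
  next
    fix Z
    assume step: "\<forall>l'\<in>set (L @ [l]). \<forall>P \<subseteq> V \<inter> l'. card P \<le> k \<longrightarrow> V \<inter> l' - P \<subseteq> Z \<longrightarrow> P \<subseteq> Z"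
      and rest: "V \<inter> \<Union>(set (L @ [l])) - (Q \<union> P) \<subseteq> Z"
    have "V \<inter> \<Union>(set L) - Q \<subseteq> Z"
      using rest P(1) by auto
    then have L: "V \<inter> \<Union>(set L) \<subseteq> Z"
      using step by (intro Q(3)) simp_all
    then have "V \<inter> l - P \<subseteq> Z"
      using rest L Q(1) unfolding set_append Union_Un_distrib list.set by blast
    then have "P \<subseteq> Z"
      using P by (intro step[rule_format, of l P]) auto
    with L \<open>V \<inter> l - P \<subseteq> Z\<close> show "V \<inter> \<Union>(set (L @ [l])) \<subseteq> Z"
      by auto
  qed
qed

text \<open>
  The bound for an arbitrary order of the T l-edges: the pivots are the vertices whose cofactors
  need not be among the functionals.
\<close>

lemma dim_spline_space_le:
  assumes mesh: "T_mesh M" and d: "d \<ge> 1" and L: "set L = T_l_edges M"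
  shows "real_fun.dim (spline_space d M) +
      (\<Sum>i<length L. min (d + 1) (card (interior_vertices M \<inter> L ! i - \<Union>(set (take i L)))))
    \<le> (d + 1)\<^sup>2 + card (cross_cuts M) * (d + 1) + card (interior_vertices M)"
proof -
  let ?V = "interior_vertices M" and ?S = "spline_space d M"
  interpret box_mesh M
    using mesh by (rule box_mesh_T_mesh)
  have finV: "finite ?V"
    using finite_vertices by (simp add: interior_vertices_def)
  have finc: "finite (cross_cuts M)"
    using finite_subset[OF _ finite_interior_runs, of "cross_cuts M"]
    by (auto simp: cross_cuts_def interior_l_edges_def)
  obtain K0 where K0: "K0 \<in> M"
    using mesh by (auto simp: T_mesh_def)
  obtain Q where Q: "Q \<subseteq> ?V \<inter> \<Union>(set L)"
    "card Q = (\<Sum>i<length L. min (d + 1) (card (?V \<inter> L ! i - \<Union>(set (take i L)))))"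
    "\<And>Z. (\<forall>l\<in>set L. \<forall>P \<subseteq> ?V \<inter> l. card P \<le> d + 1 \<longrightarrow> ?V \<inter> l - P \<subseteq> Z \<longrightarrow> P \<subseteq> Z) \<Longrightarrow>
      ?V \<inter> \<Union>(set L) - Q \<subseteq> Z \<Longrightarrow> ?V \<inter> \<Union>(set L) \<subseteq> Z"
    using pivots_exist[OF finV, of L "d + 1"] by blast
  define I where "I = ({..d} \<times> {..d}) <+> (cross_cuts M \<times> {..d}) <+> (?V - Q)"
  have "\<exists>W. finite W \<and> card W \<le> card I \<and> ?S \<subseteq> real_fun.span W"
  proof (rule real_fun.spanned_by_few_if_functionals_separate[where f = "spline_functional d M K0"])
    show "finite I"
      using finV finc by (simp add: I_def)
    show "real_fun.subspace ?S"
      by (rule subspace_spline_space)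
    show "spline_functional d M K0 i ((\<lambda>p. a * s p) + (\<lambda>p. b * t p)) =
        a * spline_functional d M K0 i s + b * spline_functional d M K0 i t"
      if "i \<in> I" "s \<in> ?S" "t \<in> ?S" for i s t a b
    proof -
      have "i \<in> ({..d} \<times> {..d}) <+> (cross_cuts M \<times> {..d}) <+> ?V"
        using that(1) by (auto simp: I_def)
      from spline_functional_linear[OF box_mesh_axioms K0 that(2,3) this]
      show ?thesis by (simp add: plus_fun_def)
    qed
    fix s assume s: "s \<in> ?S" and zero: "\<And>i. i \<in> I \<Longrightarrow> spline_functional d M K0 i s = 0"
    interpret spline_jumps M d "cell_poly d s"
      by (rule spline_jumps_cell_poly[OF _ d s]) (rule box_mesh_axioms)
    define Z where "Z = {v. cofactor M (cell_poly d s) v = 0}"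
    have "v \<in> Z" if "v \<in> ?V - Q" for v
      using zero[of "Inr (Inr v)"] that by (auto simp: I_def Z_def Plus_def)
    then have rest: "?V - Q \<subseteq> Z" by blast
    have "P \<subseteq> Z" if "l \<in> set L" "P \<subseteq> ?V \<inter> l" "card P \<le> d + 1" "?V \<inter> l - P \<subseteq> Z" for l P
      using cofactors_vanish[of l P] that L by (auto simp: Z_def)
    then have "?V \<inter> \<Union>(set L) \<subseteq> Z"
      using rest by (intro Q(3)) blast+
    then have "?V \<subseteq> Z"
      using rest Q(1) by blast
    have "s = (\<lambda>p. 0)"
    proof (rule spline_zero_if_functionals_vanish[OF mesh d s K0])
      show "cofactor M (cell_poly d s) v = 0" if "v \<in> ?V" for v
        using that \<open>?V \<subseteq> Z\<close> by (auto simp: Z_def)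
      show "spline_functional d M K0 (Inl (i, j)) s = 0" if "i \<le> d" "j \<le> d" for i j
        using that by (intro zero) (auto simp: I_def)
      show "spline_functional d M K0 (Inr (Inl (l, k))) s = 0" if "l \<in> cross_cuts M" "k \<le> d" for l k
        using that by (intro zero) (auto simp: I_def)
    qed
    then show "s = 0"
      by (simp add: zero_fun_def)
  qed
  then obtain W where "finite W" "card W \<le> card I" "?S \<subseteq> real_fun.span W"
    by blast
  then have "real_fun.dim ?S \<le> card I"
    using real_fun.dim_le_card[of ?S W] by simp
  also have "card I = (d + 1)\<^sup>2 + card (cross_cuts M) * (d + 1) + (card ?V - card Q)"
    using Q(1) finV finc finite_subset[of Q ?V]
    by (simp add: I_def card_Plus card_Diff_subset power2_eq_square)
  finally show ?thesis
    using card_mono[OF finV, of Q] Q(1,2) by auto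
qed

theorem theorem4p3:
  fixes d :: nat and M C :: "(real \<times> real) set set"
  assumes "d \<ge> 1"
    and "T_mesh M"
    and "connected (\<Union>(T_l_edges M))"
    and "\<forall>l\<in>T_l_edges M. \<not> vanishable d M l"
    and "is_CNDC d M C"
  shows "int (real_fun.dim (spline_space d M)) \<le> U_K d M C"
proof -
  let ?V = "interior_vertices M" and ?mv = "multi_vertices M C"
  interpret box_mesh M
    using assms(2) by (rule box_mesh_T_mesh)
  have finT: "finite (T_l_edges M)"
    using finite_subset[OF _ finite_interior_runs, of "T_l_edges M"]
    by (auto simp: T_l_edges_def interior_l_edges_def)
  have C: "C \<subseteq> T_l_edges M"
    using assms(5) by (simp add: is_CNDC_def regular_partition_def)
  have finC: "finite C"
    using C finT by (rule finite_subset)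
  obtain R where R: "reasonable_order d M C (T_l_edges M - C) R"
    using assms(5) unfolding is_CNDC_def regular_partition_def by blast
  then have setR: "set R = T_l_edges M - C" and distR: "distinct R"
    unfolding reasonable_order_def by (auto dest: permutations_of_setD)
  define deficit where "deficit ls i = max 0 (int (num_multi M C (ls ! i)) - int (num_vertices M (ls ! i))
      + int d + 1 - int (u_minus M C ls i))" for ls i
  have "(MIN ls \<in> permutations_of_set C. \<Sum>i < card C. deficit ls i) \<in>
      (\<lambda>ls. \<Sum>i < card C. deficit ls i) ` permutations_of_set C"
    using finC by (intro Min_in) (auto simp: permutations_of_set_empty_iff)
  then obtain ls where ls: "ls \<in> permutations_of_set C"
    "(MIN ls \<in> permutations_of_set C. \<Sum>i < card C. deficit ls i) = (\<Sum>i < card C. deficit ls i)"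
    by blast
  have setls: "set ls = C" and distls: "distinct ls"
    using ls(1) by (auto dest: permutations_of_setD)
  have lenls: "length ls = card C" and lenR: "length R = card (T_l_edges M) - card C"
    using distinct_card[OF distls] distinct_card[OF distR] setls setR card_Diff_subset[OF finC C] by simp_all
  \<comment> \<open>Within the CNDC the order is reversed: a vertex is saved by the edge that comes later in the
      order \<open>ls\<close>, as demanded by the count of vertices shared with preceding edges.\<close>
  define L where "L = rev ls @ R"
  define piv where "piv i = min (d + 1) (card (?V \<inter> L ! i - \<Union>(set (take i L))))" for i
  have setL: "set L = T_l_edges M"
    using C by (auto simp: L_def setls setR)
  have lenL: "length L = card C + length R"
    by (simp add: L_def lenls)
  have cross: "horizontal l \<and> vertical l' \<or> vertical l \<and> horizontal l'"
    if "l \<in> C" "l' \<in> C" "l \<noteq> l'" "v \<in> l" "v \<in> l'" for l l' v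
    using maximal_runs_cross[of M l l' v] maximal_run_T_l_edge that C by blast
  \<comment> \<open>Those vertices of an edge that are counted by the bound survive the deletion of the edges that
      follow it in \<open>ls\<close>: a vertex on three edges would lie on two parallel ones.\<close>
  have later: "?V \<inter> ls ! i - \<Union>(set (drop (Suc i) ls)) \<supseteq>
      (vertices M \<inter> ls ! i - ?mv) \<union> (?mv \<inter> ls ! i \<inter> \<Union>(set (take i ls)))" (is "?A \<supseteq> ?B")
    if i: "i < card C" for i
  proof
    fix v assume v: "v \<in> ?B"
    let ?l = "ls ! i"
    have l: "?l \<in> C"
      using i lenls setls nth_mem by metis
    have disj: "?l \<notin> set (take i ls)" "?l \<notin> set (drop (Suc i) ls)"
      "set (take i ls) \<inter> set (drop (Suc i) ls) = {}"
      using distls i lenls by (subst (asm) id_take_nth_drop[of i ls]; simp)+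
    have sub: "set (take i ls) \<subseteq> C" "set (drop (Suc i) ls) \<subseteq> C"
      using set_take_subset[of i ls] set_drop_subset[of "Suc i" ls] setls by auto
    have vert: "v \<in> vertices M" "v \<in> ?l"
      using v by (auto simp: multi_vertices_def)
    have "v \<notin> l'" if l': "l' \<in> set (drop (Suc i) ls)" for l'
    proof
      assume "v \<in> l'"
      have "l' \<in> C" "?l \<noteq> l'"
        using l' sub disj(2) by auto
      note c = cross[OF l this vert(2) \<open>v \<in> l'\<close>]
      have "v \<in> ?mv"
        unfolding multi_vertices_def using c l \<open>l' \<in> C\<close> vert \<open>v \<in> l'\<close> by blast
      then obtain l'' where l'': "l'' \<in> set (take i ls)" "v \<in> l''"
        using v by blast
      have "l'' \<in> C" "?l \<noteq> l''" "l' \<noteq> l''"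
        using l'' l' sub disj by auto
      then show False
        using c cross[OF l \<open>l'' \<in> C\<close> \<open>?l \<noteq> l''\<close> vert(2) l''(2)]
          cross[OF \<open>l' \<in> C\<close> \<open>l'' \<in> C\<close> \<open>l' \<noteq> l''\<close> \<open>v \<in> l'\<close> l''(2)]
          not_horizontal_and_vertical by blast
    qed
    moreover have "v \<in> ?V"
      using T_l_edge_vertices[of ?l] l C vert by blast
    ultimately show "v \<in> ?A"
      using vert by blast
  qed
  have piv_C: "int d + 1 - deficit ls i \<le> int (piv (card C - Suc i))" if i: "i < card C" for i
  proof -
    let ?l = "ls ! i"
    have fin: "finite (vertices M \<inter> ?l)"
      using finite_vertices by simp
    have "take (card C - Suc i) L = rev (drop (Suc i) ls)" "L ! (card C - Suc i) = ?l"
      using i lenls by (auto simp: L_def take_rev nth_append rev_nth)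
    then have p: "piv (card C - Suc i) = min (d + 1) (card (?V \<inter> ?l - \<Union>(set (drop (Suc i) ls))))"
      by (simp add: piv_def)
    have "?mv \<inter> ?l \<subseteq> vertices M \<inter> ?l"
      by (auto simp: multi_vertices_def)
    have "vertices M \<inter> ?l - ?mv = vertices M \<inter> ?l - ?mv \<inter> ?l"
      by blast
    with \<open>?mv \<inter> ?l \<subseteq> vertices M \<inter> ?l\<close> have "card (vertices M \<inter> ?l - ?mv) = num_vertices M ?l - num_multi M C ?l" "num_multi M C ?l \<le> num_vertices M ?l"
      unfolding num_vertices_def num_multi_def
      using fin by (simp_all only: card_Diff_subset[OF finite_subset] card_mono)
    moreover have "card ((vertices M \<inter> ?l - ?mv) \<union> (?mv \<inter> ?l \<inter> \<Union>(set (take i ls)))) =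
        card (vertices M \<inter> ?l - ?mv) + u_minus M C ls i"
      unfolding u_minus_def using fin finite_subset[OF \<open>?mv \<inter> ?l \<subseteq> vertices M \<inter> ?l\<close> fin]
      by (intro card_Un_disjoint) auto
    moreover have "card ((vertices M \<inter> ?l - ?mv) \<union> (?mv \<inter> ?l \<inter> \<Union>(set (take i ls)))) \<le>
        card (?V \<inter> ?l - \<Union>(set (drop (Suc i) ls)))"
      using later[OF i] finite_vertices by (intro card_mono) (auto simp: interior_vertices_def)
    ultimately show ?thesis
      unfolding p deficit_def by linarith
  qed
  have piv_R: "piv (card C + j) = d + 1" if j: "j < length R" for j
  proof -
    have "take (card C + j) L = rev ls @ take j R" "L ! (card C + j) = R ! j"
      using lenls by (auto simp: L_def nth_append)
    moreover have "?V \<inter> R ! j = vertices M \<inter> R ! j"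
      using T_l_edge_vertices[of "R ! j"] nth_mem[OF j] setR by blast
    ultimately have "?V \<inter> L ! (card C + j) - \<Union>(set (take (card C + j) L)) =
        vertices M \<inter> R ! j - \<Union>C - \<Union>(set (take j R))"
      by (simp add: setls) blast
    moreover have "d + 1 \<le> card (vertices M \<inter> R ! j - \<Union>C - \<Union>(set (take j R)))"
      using R j by (simp add: reasonable_order_def)
    ultimately show ?thesis
      by (simp add: piv_def)
  qed
  define D where "D = int d + 1"
  have "(\<Sum>i<card C. D - deficit ls i) \<le> (\<Sum>i<card C. int (piv (card C - Suc i)))"
    using piv_C by (intro sum_mono) (simp add: D_def)
  also have "\<dots> = (\<Sum>i<card C. int (piv i))"
    by (rule sum.nat_diff_reindex)
  finally have "int (card C) * D - (\<Sum>i<card C. deficit ls i) \<le> (\<Sum>i<card C. int (piv i))"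
    by (simp add: sum_subtractf)
  moreover have "(\<Sum>i<a + b. f i) = (\<Sum>i<a. f i) + (\<Sum>j<b. f (a + j))" for a b and f :: "nat \<Rightarrow> int"
    by (induction b) simp_all
  then have "(\<Sum>i<length L. int (piv i)) = (\<Sum>i<card C. int (piv i)) + (\<Sum>j<length R. int (piv (card C + j)))"
    unfolding lenL by blast
  moreover have "(\<Sum>j<length R. int (piv (card C + j))) = (int (card (T_l_edges M)) - int (card C)) * D"
    using piv_R card_mono[OF finT C] by (simp add: lenR D_def of_nat_diff)
  moreover have "int (real_fun.dim (spline_space d M)) + (\<Sum>i<length L. int (piv i)) \<le>
      D\<^sup>2 + int (card (cross_cuts M)) * D + int (card ?V)"
  proof -
    have "int (real_fun.dim (spline_space d M) + (\<Sum>i<length L. piv i)) \<le>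
        int ((d + 1)\<^sup>2 + card (cross_cuts M) * (d + 1) + card ?V)"
      unfolding of_nat_le_iff using dim_spline_space_le[OF assms(2,1) setL] unfolding piv_def .
    moreover have "D = int (d + 1)"
      by (simp add: D_def)
    ultimately show ?thesis
      by (simp only: of_nat_add of_nat_mult of_nat_power of_nat_sum)
  qed
  moreover have "U_K d M C = D\<^sup>2 + (int (card (cross_cuts M)) - int (card (T_l_edges M))) * D
      + int (card ?V) + (\<Sum>i < card C. deficit ls i)"
    using ls(2) by (simp add: U_K_def deficit_def D_def)
  ultimately show ?thesis
    by (simp add: left_diff_distrib)
qed

end
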